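(* (Chain rule II) Let $C$ be a convex subset of a real vector space that is symmetric with respect to a point $x_0\in C$, let $\mu$ be the Minkowski functional of $C-x_0$, let $h=(h_1,\dots,h_n):C\to\mathbb{R}^n$ be a function such that each component $h_i$ is $\mu$-Lipschitz on $C$, and let $g:\mathbb{R}^n\to\mathbb{R}$ be a Lipschitz function. Denote $\varphi:=g\circ h$ (that is, $\varphi(x)=g(h(x))$) and let $X_0:=\operatorname{span}(C-x_0)$ be supplied with a vector topology such that $\mu$ is continuous. Then for all $x\in B_\mu(x_0,1)$, $$\partial^\mu_C\varphi(x)\subset\overline{\operatorname{co}}\left\{\sum_{i=1}^n\alpha_i\zeta_i:\zeta_i\in\partial^\mu_Ch_i(x),\ \alpha=(\alpha_1,\dots,\alpha_n)\in\partial_Cg(h(x))\right\},$$ where $\overline{\operatorname{co}}$ denotes the closed convex hull in the topology $\sigma(X_0^*,X_0)$.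
   Context: $C$ is symmetric with respect to $x_0$ if $C-x_0=-(C-x_0)$. $X_0'$ is the algebraic dual and $X_0^*$ the topological dual of $X_0$; $\sigma(X_0^*,X_0)$ is the topology of pointwise convergence on $X_0$. The Minkowski functional is $\mu(v)=\inf\{t>0:v\in t(C-x_0)\}$ (a finite seminorm on $X_0$). $B_\mu(x_0,1):=\{x\in x_0+X_0:\mu(x-x_0)<1\}\subset C$. A function $f:C\to\mathbb{R}$ is $\mu$-Lipschitz if for some $L>0$, $|f(x)-f(y)|\le L\mu(x-y)$ for all $x,y\in C$. For such $f$, $x\in B_\mu(x_0,1)$, $v\in X_0$, $$f^\circ(x,v):=\limsup_{\mu(y-x)\to0,\ t\to0+}\frac{f(y+tv)-f(y)}{t},\qquad \partial^\mu_Cf(x):=\{\zeta\in X_0':f^\circ(x,v)\ge\langle\zeta,v\rangle\ \forall v\in X_0\}$$ (when $\mu$ is continuous these sets lie in $X_0^*$). $\partial_Cg$ is the usual Clarke subdifferential of a Lipschitz function on $\mathbb{R}^n$, viewed as a subset of $\mathbb{R}^n$. *)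

theory Defs
  imports "HOL-Analysis.Analysis"
begin

definition translate_to_origin :: "'a::real_vector set \<Rightarrow> 'a \<Rightarrow> 'a set" where
  "translate_to_origin C x0 = (\<lambda>c. c - x0) ` C"

definition symmetric_wrt :: "'a::real_vector set \<Rightarrow> 'a \<Rightarrow> bool" where
  "symmetric_wrt C x0 \<longleftrightarrow> translate_to_origin C x0 = uminus ` translate_to_origin C x0"

definition dir_space :: "'a::real_vector set \<Rightarrow> 'a \<Rightarrow> 'a set" where
  "dir_space C x0 = span (translate_to_origin C x0)"

text \<open>Meaningful for \<open>v \<in> dir_space C x0\<close> only: elsewhere the infimum is taken over the
  empty set. All uses below are restricted accordingly.\<close>

definition minkowski :: "'a::real_vector set \<Rightarrow> 'a \<Rightarrow> 'a \<Rightarrow> real" where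
  "minkowski C x0 v = Inf {t. t > 0 \<and> v \<in> (\<lambda>c. t *\<^sub>R c) ` translate_to_origin C x0}"

definition minkowski_ball :: "'a::real_vector set \<Rightarrow> 'a \<Rightarrow> real \<Rightarrow> 'a set" where
  "minkowski_ball C x0 r = {x. x - x0 \<in> dir_space C x0 \<and> minkowski C x0 (x - x0) < r}"

definition minkowski_lipschitz :: "'a::real_vector set \<Rightarrow> 'a \<Rightarrow> ('a \<Rightarrow> real) \<Rightarrow> bool" where
  "minkowski_lipschitz C x0 f \<longleftrightarrow>
     (\<exists>L>0. \<forall>x\<in>C. \<forall>y\<in>C. \<bar>f x - f y\<bar> \<le> L * minkowski C x0 (x - y))"

text \<open>Linear functionals on a subspace \<open>S\<close> are represented by functions that are
  \<open>undefined\<close> outside \<open>S\<close>, so that equality of functions is equality on \<open>S\<close>.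
  Correspondingly, linear combinations of functionals are restricted to \<open>S\<close>.\<close>

definition algebraic_dual :: "'a::real_vector set \<Rightarrow> ('a \<Rightarrow> real) set" where
  "algebraic_dual S = {\<zeta> \<in> extensional S.
     (\<forall>u\<in>S. \<forall>v\<in>S. \<zeta> (u + v) = \<zeta> u + \<zeta> v) \<and> (\<forall>c. \<forall>v\<in>S. \<zeta> (c *\<^sub>R v) = c * \<zeta> v)}"

text \<open>As usual, a vector topology is not required to be Hausdorff.\<close>

definition vector_topology_on :: "'a::real_vector set \<Rightarrow> 'a topology \<Rightarrow> bool" where
  "vector_topology_on S T \<longleftrightarrow> topspace T = S \<and>
     continuous_map (prod_topology T T) T (\<lambda>(u, v). u + v) \<and>
     continuous_map (prod_topology euclideanreal T) T (\<lambda>(c, v). c *\<^sub>R v)"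

definition topological_dual :: "'a::real_vector topology \<Rightarrow> ('a \<Rightarrow> real) set" where
  "topological_dual T = {\<zeta> \<in> algebraic_dual (topspace T). continuous_map T euclideanreal \<zeta>}"

definition weak_star_topology :: "'a::real_vector topology \<Rightarrow> ('a \<Rightarrow> real) topology" where
  "weak_star_topology T =
     subtopology (product_topology (\<lambda>_. euclideanreal) (topspace T)) (topological_dual T)"

definition convex_functionals :: "'a::real_vector set \<Rightarrow> ('a \<Rightarrow> real) set \<Rightarrow> bool" where
  "convex_functionals S K \<longleftrightarrow> (\<forall>\<zeta>\<in>K. \<forall>\<eta>\<in>K. \<forall>u v. u \<ge> 0 \<longrightarrow> v \<ge> 0 \<longrightarrow> u + v = 1 \<longrightarrow>
     (\<lambda>w\<in>S. u * \<zeta> w + v * \<eta> w) \<in> K)"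

definition weak_star_closed_convex_hull ::
  "'a::real_vector topology \<Rightarrow> ('a \<Rightarrow> real) set \<Rightarrow> ('a \<Rightarrow> real) set" where
  "weak_star_closed_convex_hull T A =
     weak_star_topology T closure_of (convex_functionals (topspace T) hull A)"

text \<open>The upper limit of \<open>(f (y + t v) - f y) / t\<close> as \<open>y\<close> tends to the base point along the
  filter \<open>F\<close> (which admits the base point itself) and \<open>t\<close> tends to \<open>0\<close> from the right.\<close>

definition clarke_derivative ::
  "'a::real_vector filter \<Rightarrow> ('a \<Rightarrow> real) \<Rightarrow> 'a \<Rightarrow> ereal" where
  "clarke_derivative F f v =
     Limsup (F \<times>\<^sub>F at_right 0) (\<lambda>(y, t). ereal ((f (y + t *\<^sub>R v) - f y) / t))"

definition clarke_subdifferential :: "(real ^ 'n \<Rightarrow> real) \<Rightarrow> real ^ 'n \<Rightarrow> (real ^ 'n) set" where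
  "clarke_subdifferential g z = {\<alpha>. \<forall>w. clarke_derivative (nhds z) g w \<ge> ereal (\<alpha> \<bullet> w)}"

definition minkowski_nhds :: "'a::real_vector set \<Rightarrow> 'a \<Rightarrow> 'a \<Rightarrow> 'a filter" where
  "minkowski_nhds C x0 x =
     inf (filtercomap (\<lambda>y. minkowski C x0 (y - x)) (nhds 0)) (principal {y. y - x \<in> dir_space C x0})"

text \<open>For \<open>x \<in> minkowski_ball C x0 1\<close> the points \<open>y\<close> and \<open>y + t v\<close> eventually lie in \<open>C\<close>,
  so that the values of \<open>f\<close> outside \<open>C\<close> are irrelevant.\<close>

definition minkowski_subdifferential ::
  "'a::real_vector set \<Rightarrow> 'a \<Rightarrow> ('a \<Rightarrow> real) \<Rightarrow> 'a \<Rightarrow> ('a \<Rightarrow> real) set" where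
  "minkowski_subdifferential C x0 f x = {\<zeta> \<in> algebraic_dual (dir_space C x0).
     \<forall>v\<in>dir_space C x0. clarke_derivative (minkowski_nhds C x0 x) f v \<ge> ereal (\<zeta> v)}"

end

theory Submission
  imports Defs
begin

text \<open>Fix \<open>v\<close>. Along points \<open>(y, t)\<close> at which the quotient of \<open>\<phi> = g \<circ> h\<close> exceeds a number \<open>s\<close> below
  \<open>\<phi>\<degree>(x, v)\<close>, the bounded vectors \<open>(h (y + t v) - h y) / t\<close> have a cluster point \<open>q\<close>. Then
  \<open>-h\<^sub>i\<degree>(x, -v) \<le> q\<^sub>i \<le> h\<^sub>i\<degree>(x, v)\<close>, and \<open>s \<le> g\<degree>(h x, q)\<close> because \<open>g\<close> is Lipschitz. By Hahn--Banach there
  are \<open>\<alpha> \<in> \<partial>g(h x)\<close> with \<open>\<alpha> \<bullet> q = g\<degree>(h x, q)\<close> and \<open>\<zeta>\<^sub>i \<in> \<partial>h\<^sub>i(x)\<close> with \<open>\<zeta>\<^sub>i v = q\<^sub>i\<close>, so that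
  \<open>s \<le> \<Sum>\<^sub>i \<alpha>\<^sub>i \<zeta>\<^sub>i v\<close>. Hence \<open>\<phi>\<degree>(x, \<cdot>)\<close> is at most the support function of the set on the right-hand
  side, and the inclusion follows by separation in finitely many coordinates.\<close>

subsection \<open>Sublinear functionals and the Hahn--Banach theorem\<close>

text \<open>Positive homogeneity is asked for as an inequality, the form that infima inherit;
  equality and \<open>p 0 = 0\<close> follow on a subspace.\<close>

definition sublinear_on :: "'a::real_vector set \<Rightarrow> ('a \<Rightarrow> real) \<Rightarrow> bool" where
  "sublinear_on S p \<longleftrightarrow> (\<forall>u\<in>S. \<forall>v\<in>S. p (u + v) \<le> p u + p v) \<and> (\<forall>c>0. \<forall>v\<in>S. p (c *\<^sub>R v) \<le> c * p v)"

lemma sublinear_onD: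
  assumes "sublinear_on S p"
  shows "u \<in> S \<Longrightarrow> v \<in> S \<Longrightarrow> p (u + v) \<le> p u + p v"
    and "c > 0 \<Longrightarrow> v \<in> S \<Longrightarrow> p (c *\<^sub>R v) \<le> c * p v"
  using assms by (auto simp: sublinear_on_def)

lemma sublinear_on_zero:
  assumes "sublinear_on S p" "subspace S"
  shows "p 0 = 0"
  using sublinear_onD(2)[OF assms(1), of 2 0] sublinear_onD(2)[OF assms(1), of "1/2" 0]
    subspace_0[OF assms(2)] by simp

lemma sublinear_on_scale:
  assumes p: "sublinear_on S p" and S: "subspace S" and "c \<ge> 0" "v \<in> S"
  shows "p (c *\<^sub>R v) = c * p v"
proof (cases "c = 0")
  case True
  then show ?thesis using sublinear_on_zero[OF p S] by simp
next
  case False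
  then have c: "c > 0" using assms by simp
  have "p v \<le> (1 / c) * p (c *\<^sub>R v)"
    using sublinear_onD(2)[OF p, of "1/c" "c *\<^sub>R v"] c \<open>v \<in> S\<close> S by (simp add: subspace_scale)
  then show ?thesis
    using sublinear_onD(2)[OF p c \<open>v \<in> S\<close>] c by (simp add: field_simps)
qed

lemma sublinear_on_ge_neg:
  assumes "sublinear_on S p" "subspace S" "v \<in> S"
  shows "- p (- v) \<le> p v"
  using sublinear_onD(1)[OF assms(1), of v "- v"] sublinear_on_zero[OF assms(1,2)]
    subspace_neg[OF assms(2,3)] assms(3) by simp

text \<open>Serves two infima: over the real parameter of a shift along a line, and over a chain in
  Zorn's lemma. In both, a single index \<open>k\<close> can be found that handles a sum, and the
  lower bound keeps the infima finite.\<close>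

lemma sublinear_on_INF:
  assumes S: "subspace S" and I: "I \<noteq> {}"
    and bdd: "\<And>v. v \<in> S \<Longrightarrow> bdd_below ((\<lambda>i. q i v) ` I)"
    and add: "\<And>i j u v. i \<in> I \<Longrightarrow> j \<in> I \<Longrightarrow> u \<in> S \<Longrightarrow> v \<in> S \<Longrightarrow> \<exists>k\<in>I. q k (u + v) \<le> q i u + q j v"
    and scale: "\<And>i c v. i \<in> I \<Longrightarrow> c > 0 \<Longrightarrow> v \<in> S \<Longrightarrow> \<exists>k\<in>I. q k (c *\<^sub>R v) \<le> c * q i v"
  shows "sublinear_on S (\<lambda>v\<in>S. INF i\<in>I. q i v)"
proof -
  have low: "(INF i\<in>I. q i v) \<le> b" if "v \<in> S" "i \<in> I" "q i v \<le> b" for v i b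
    using cINF_lower2[OF bdd] that by blast
  have "(INF i\<in>I. q i (u + v)) \<le> (INF i\<in>I. q i u) + (INF i\<in>I. q i v)" if "u \<in> S" "v \<in> S" for u v
  proof -
    let ?m = "INF i\<in>I. q i (u + v)"
    have uv: "u + v \<in> S" using that S by (simp add: subspace_add)
    have "?m - q j v \<le> q i u" if ij: "i \<in> I" "j \<in> I" for i j
    proof -
      obtain k where "k \<in> I" "q k (u + v) \<le> q i u + q j v"
        using add[OF ij \<open>u \<in> S\<close> \<open>v \<in> S\<close>] by blast
      then have "?m \<le> q i u + q j v" by (rule low[OF uv])
      then show ?thesis by simp
    qed
    then have "?m - q j v \<le> (INF i\<in>I. q i u)" if "j \<in> I" for j
      using that by (intro cINF_greatest I)
    then have "?m - (INF i\<in>I. q i u) \<le> (INF i\<in>I. q i v)"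
      by (intro cINF_greatest I) (simp add: algebra_simps)
    then show ?thesis by simp
  qed
  moreover have "(INF i\<in>I. q i (c *\<^sub>R v)) \<le> c * (INF i\<in>I. q i v)" if "c > 0" "v \<in> S" for c v
  proof -
    let ?m = "INF i\<in>I. q i (c *\<^sub>R v)"
    have cv: "c *\<^sub>R v \<in> S" using that S by (simp add: subspace_scale)
    have "?m / c \<le> q i v" if i: "i \<in> I" for i
    proof -
      obtain k where "k \<in> I" "q k (c *\<^sub>R v) \<le> c * q i v"
        using scale[OF i \<open>c > 0\<close> \<open>v \<in> S\<close>] by blast
      then have "?m \<le> c * q i v" by (rule low[OF cv])
      then show ?thesis using \<open>c > 0\<close> by (simp add: field_simps)
    qed
    then have "?m / c \<le> (INF i\<in>I. q i v)"
      by (intro cINF_greatest I)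
    then show ?thesis using that by (simp add: field_simps)
  qed
  ultimately show ?thesis
    using S by (simp add: sublinear_on_def subspace_add subspace_scale)
qed

text \<open>\<open>q u\<close> is the infimum of \<open>p (u + t *\<^sub>R v) - t * c\<close> over
  all real \<open>t\<close>. The bounds on \<open>c\<close> put \<open>t * c\<close> below
  \<open>p\<close> on the line through \<open>v\<close>, which keeps the infimum finite. The choice
  \<open>t = 0\<close> gives \<open>q \<le> p\<close>; \<open>t = -1\<close> at \<open>v\<close> and
  \<open>t = 1\<close> at \<open>- v\<close> force a linear functional below \<open>q\<close> to
  take the value \<open>c\<close> at \<open>v\<close>.\<close>

lemma sublinear_on_shift:
  assumes p: "sublinear_on S p" and S: "subspace S" and v: "v \<in> S"
    and c: "- p (- v) \<le> c" "c \<le> p v"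
  shows "\<exists>q. sublinear_on S q \<and> q \<in> extensional S \<and> (\<forall>u\<in>S. \<forall>t. q u \<le> p (u + t *\<^sub>R v) - t * c)"
proof -
  define Q where "Q = (\<lambda>t u. p (u + t *\<^sub>R v) - t * c)"
  define q where "q = (\<lambda>u\<in>S. INF t. Q t u)"
  have line: "t * c \<le> p (t *\<^sub>R v)" for t
  proof (cases "t \<ge> 0")
    case True
    then show ?thesis using sublinear_on_scale[OF p S _ v] c by (simp add: mult_left_mono)
  next
    case False
    then have "p (t *\<^sub>R v) = - t * p (- v)"
      using sublinear_on_scale[OF p S, of "- t" "- v"] subspace_neg[OF S v] by simp
    moreover have "- t * - c \<le> - t * p (- v)" using c False by (intro mult_left_mono) auto
    ultimately show ?thesis by simp
  qed
  have mem: "u + t *\<^sub>R v \<in> S" if "u \<in> S" for u t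
    using that S v by (simp add: subspace_add subspace_scale)
  \<comment> \<open>Splitting \<open>t *\<^sub>R v\<close> as
    \<open>(u + t *\<^sub>R v) + (- u)\<close> gives a lower bound that is the same for all
    \<open>t\<close>.\<close>
  have bdd: "bdd_below (range (\<lambda>t. Q t u))" if "u \<in> S" for u
  proof (rule bdd_belowI2)
    fix t
    have "p (t *\<^sub>R v) \<le> p (u + t *\<^sub>R v) + p (- u)"
      using sublinear_onD(1)[OF p mem[OF that, of t] subspace_neg[OF S that]] by simp
    then show "- p (- u) \<le> Q t u" using line[of t] by (simp add: Q_def)
  qed
  have "sublinear_on S q"
    unfolding q_def
  proof (rule sublinear_on_INF[OF S _ bdd])
    fix i j :: real and u w assume "u \<in> S" "w \<in> S"
    then have "Q (i + j) (u + w) \<le> Q i u + Q j w"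
      using sublinear_onD(1)[OF p mem[of u i] mem[of w j]]
      by (simp add: Q_def algebra_simps)
    then show "\<exists>k\<in>UNIV. Q k (u + w) \<le> Q i u + Q j w" by blast
  next
    fix i r :: real and u assume "r > 0" "u \<in> S"
    then have "Q (r * i) (r *\<^sub>R u) \<le> r * Q i u"
      using sublinear_onD(2)[OF p _ mem[of u i], of r]
      by (simp add: Q_def algebra_simps)
    then show "\<exists>k\<in>UNIV. Q k (r *\<^sub>R u) \<le> r * Q i u" by blast
  qed auto
  moreover have "q u \<le> p (u + t *\<^sub>R v) - t * c" if "u \<in> S" for u t
    using cINF_lower[OF bdd[OF that], of t] that by (simp add: q_def Q_def)
  moreover have "q \<in> extensional S" by (simp add: q_def)
  ultimately show ?thesis by blast
qed

text \<open>Shifting along \<open>v\<close> with \<open>c = q v\<close> gives a functional below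
  \<open>q\<close>, hence \<open>q\<close> itself by minimality. Its bound at \<open>t = 1\<close>
  reads \<open>q u \<le> q (u + v) - q v\<close>, the converse of subadditivity.\<close>

lemma minimal_sublinear_on_linear:
  assumes q: "sublinear_on S q" "q \<in> extensional S" and S: "subspace S"
    and min: "\<And>r. sublinear_on S r \<Longrightarrow> r \<in> extensional S \<Longrightarrow> (\<And>u. u \<in> S \<Longrightarrow> r u \<le> q u) \<Longrightarrow> r = q"
  shows "q \<in> algebraic_dual S"
proof -
  have add: "q (u + v) = q u + q v" if uv: "u \<in> S" "v \<in> S" for u v
  proof -
    obtain r where r: "sublinear_on S r" "r \<in> extensional S"
      "\<forall>u\<in>S. \<forall>t. r u \<le> q (u + t *\<^sub>R v) - t * q v"
      using sublinear_on_shift[OF q(1) S uv(2), of "q v"] sublinear_on_ge_neg[OF q(1) S uv(2)] by blast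
    have "r u \<le> q u" if "u \<in> S" for u using r(3)[rule_format, OF that, of 0] by simp
    then have "r = q" by (rule min[OF r(1,2)])
    then show ?thesis
      using r(3)[rule_format, OF uv(1), of 1] sublinear_onD(1)[OF q(1) uv] by simp
  qed
  have neg: "q (- v) = - q v" if "v \<in> S" for v
    using add[OF that subspace_neg[OF S that]] sublinear_on_zero[OF q(1) S] by simp
  have "q (c *\<^sub>R v) = c * q v" if v: "v \<in> S" for c v
  proof (cases "c \<ge> 0")
    case True
    then show ?thesis by (rule sublinear_on_scale[OF q(1) S _ v])
  next
    case False
    then show ?thesis
      using sublinear_on_scale[OF q(1) S _ v, of "- c"] neg[OF subspace_scale[OF S v, of "-c"]] by simp
  qed
  then show ?thesis using add q(2) by (simp add: algebraic_dual_def)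
qed

text \<open>Hahn--Banach: a minimal sublinear functional below \<open>p\<close> exists by Zorn's lemma, and
  the shift construction shows that it is linear.\<close>

lemma linear_below_sublinear:
  assumes p: "sublinear_on S p" and S: "subspace S"
  shows "\<exists>\<zeta>\<in>algebraic_dual S. \<forall>u\<in>S. \<zeta> u \<le> p u"
proof -
  define A where "A = {q. sublinear_on S q \<and> q \<in> extensional S \<and> (\<forall>u\<in>S. q u \<le> p u)}"
  \<comment> \<open>The order is reversed, so that a maximal element in Zorn's lemma is a minimal
    sublinear functional.\<close>
  define R where "R = (\<lambda>q r :: 'a \<Rightarrow> real. \<forall>u\<in>S. r u \<le> q u)"
  \<comment> \<open>A lower bound common to all of \<open>A\<close> makes the infimum of a chain
    finite.\<close>
  have low: "- p (- u) \<le> q u" if "q \<in> A" "u \<in> S" for q u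
  proof -
    have "q (- u) \<le> p (- u)" "- q (- u) \<le> q u"
      using sublinear_on_ge_neg[OF _ S, of q u] that subspace_neg[OF S that(2)] by (auto simp: A_def)
    then show ?thesis by simp
  qed
  have "\<exists>m\<in>A. \<forall>a\<in>A. R m a \<longrightarrow> a = m"
  proof (rule predicate_Zorn)
    show "partial_order_on A (relation_of R A)"
    proof (rule partial_order_on_relation_ofI)
      fix a b assume "a \<in> A" "b \<in> A" "R a b" "R b a"
      then show "a = b"
        by (intro extensionalityI[of _ S]) (auto simp: A_def R_def order_antisym)
    next
      fix a b c assume "R a b" "R b c"
      then show "R a c" unfolding R_def by (blast intro: order_trans)
    qed (simp add: R_def)
  next
    fix K assume K: "K \<in> Chains (relation_of R A)"
    then have KA: "K \<subseteq> A" by (auto simp: Chains_def relation_of_def)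
    show "\<exists>u\<in>A. \<forall>a\<in>K. R a u"
    proof (cases "K = {}")
      case True
      have "restrict p S \<in> A"
        using p S by (auto simp: A_def sublinear_on_def subspace_add subspace_scale)
      then show ?thesis using True by blast
    next
      case False
      have bdd: "bdd_below ((\<lambda>q. q u) ` K)" if "u \<in> S" for u
        using low that KA by (intro bdd_belowI2[of _ "- p (- u)"]) auto
      have K_sub: "sublinear_on S q" if "q \<in> K" for q using that KA by (auto simp: A_def)
      have "sublinear_on S (\<lambda>u\<in>S. INF q\<in>K. q u)"
      proof (rule sublinear_on_INF[OF S False bdd])
        fix q r u v assume *: "q \<in> K" "r \<in> K" "u \<in> S" "v \<in> S"
        \<comment> \<open>Of two members of the chain, the smaller one serves as the index
          \<open>k\<close> for the sum.\<close>
        then have "R q r \<or> R r q" using K by (auto simp: Chains_def relation_of_def)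
        then show "\<exists>k\<in>K. k (u + v) \<le> q u + r v"
        proof
          assume "R q r"
          then have "r (u + v) \<le> q u + r v"
            using * sublinear_onD(1)[OF K_sub, of r u v] by (auto simp: R_def)
          then show ?thesis using * by blast
        next
          assume "R r q"
          then have "q (u + v) \<le> q u + r v"
            using * sublinear_onD(1)[OF K_sub, of q u v] by (auto simp: R_def)
          then show ?thesis using * by blast
        qed
      next
        fix q c v assume "q \<in> K" "(c::real) > 0" "v \<in> S"
        then show "\<exists>k\<in>K. k (c *\<^sub>R v) \<le> c * q v"
          using sublinear_onD(2)[OF K_sub] by blast
      qed
      moreover have inf_le: "(INF q\<in>K. q u) \<le> q u" if "q \<in> K" "u \<in> S" for q u
        using cINF_lower[OF bdd] that by blast
      moreover obtain q where "q \<in> K" using False by blast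
      then have "(INF q\<in>K. q u) \<le> p u" if "u \<in> S" for u
        using order_trans[OF inf_le[OF _ that]] KA that by (auto simp: A_def)
      ultimately have "(\<lambda>u\<in>S. INF q\<in>K. q u) \<in> A" by (simp add: A_def)
      then show ?thesis using inf_le by (intro bexI) (auto simp: R_def)
    qed
  qed
  then obtain m where m: "m \<in> A" and min: "\<And>a. a \<in> A \<Longrightarrow> R m a \<Longrightarrow> a = m" by blast
  have "m \<in> algebraic_dual S"
  proof (rule minimal_sublinear_on_linear[OF _ _ S])
    fix r assume "sublinear_on S r" "r \<in> extensional S" "\<And>u. u \<in> S \<Longrightarrow> r u \<le> m u"
    moreover have "\<forall>u\<in>S. m u \<le> p u" using m by (simp add: A_def)
    ultimately show "r = m"
      by (intro min) (auto simp: A_def R_def intro: order_trans[of "r _" "m _"])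
  qed (use m in \<open>auto simp: A_def\<close>)
  then show ?thesis using m by (auto simp: A_def)
qed

lemma algebraic_dualD:
  assumes "\<zeta> \<in> algebraic_dual S"
  shows "u \<in> S \<Longrightarrow> v \<in> S \<Longrightarrow> \<zeta> (u + v) = \<zeta> u + \<zeta> v"
    and "v \<in> S \<Longrightarrow> \<zeta> (c *\<^sub>R v) = c * \<zeta> v"
  using assms by (auto simp: algebraic_dual_def)

lemma algebraic_dual_uminus:
  assumes "\<zeta> \<in> algebraic_dual S" "v \<in> S"
  shows "\<zeta> (- v) = - \<zeta> v"
  using algebraic_dualD(2)[OF assms, of "- 1"] by simp

text \<open>Hahn-Banach is applied to the shifted functional, whose bounds at \<open>v\<close> and
  \<open>- v\<close> pin the value \<open>c\<close>. This is the source of subgradients with a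
  prescribed value in one direction.\<close>

lemma linear_below_sublinear_at:
  assumes p: "sublinear_on S p" and S: "subspace S" and v: "v \<in> S"
    and c: "- p (- v) \<le> c" "c \<le> p v"
  shows "\<exists>\<zeta>\<in>algebraic_dual S. (\<forall>u\<in>S. \<zeta> u \<le> p u) \<and> \<zeta> v = c"
proof -
  obtain q where q: "sublinear_on S q" "q \<in> extensional S" "\<forall>u\<in>S. \<forall>t. q u \<le> p (u + t *\<^sub>R v) - t * c"
    using sublinear_on_shift[OF p S v c] by blast
  obtain \<zeta> where \<zeta>: "\<zeta> \<in> algebraic_dual S" "\<forall>u\<in>S. \<zeta> u \<le> q u"
    using linear_below_sublinear[OF q(1) S] by blast
  have "p 0 = 0" by (rule sublinear_on_zero[OF p S])
  moreover have "\<zeta> v \<le> p (v + (- 1) *\<^sub>R v) - (- 1) * c"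
    by (rule order_trans[OF \<zeta>(2)[rule_format, OF v] q(3)[rule_format, OF v]])
  moreover have "\<zeta> (- v) \<le> p (- v + 1 *\<^sub>R v) - 1 * c"
    by (rule order_trans[OF \<zeta>(2)[rule_format, OF subspace_neg[OF S v]] q(3)[rule_format, OF subspace_neg[OF S v]]])
  moreover have "\<zeta> (- v) = - \<zeta> v" by (rule algebraic_dual_uminus[OF \<zeta>(1) v])
  ultimately have "\<zeta> v = c" by simp
  moreover have "\<zeta> u \<le> p u" if "u \<in> S" for u
    using order_trans[OF \<zeta>(2)[rule_format, OF that] q(3)[rule_format, OF that, of 0]] by simp
  ultimately show ?thesis using \<zeta>(1) by blast
qed

subsection \<open>The Clarke derivative along a filter\<close>

text \<open>Abstracts what \<open>nhds z\<close> in Euclidean space and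
  \<open>minkowski_nhds\<close> have in common: small shifts along \<open>S\<close> respect the
  filter, and difference quotients are eventually bounded. Both kinds of Clarke derivative are thus
  treated at once.\<close>

locale clarke_setting =
  fixes S :: "'a::real_vector set" and F :: "'a filter" and f :: "'a \<Rightarrow> real" and p :: "'a \<Rightarrow> real"
  assumes S: "subspace S"
    and F: "F \<noteq> bot"
    and shift: "u \<in> S \<Longrightarrow> filterlim (\<lambda>(y, t). y + t *\<^sub>R u) F (F \<times>\<^sub>F at_right 0)"
    and bounded: "v \<in> S \<Longrightarrow>
      \<forall>\<^sub>F (y, t) in F \<times>\<^sub>F at_right 0. \<bar>(f (y + t *\<^sub>R v) - f y) / t\<bar> \<le> p v"
begin

text \<open>The quotient bound keeps the derivative finite on \<open>S\<close>, so nothing is lost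
  there in passing to real numbers.\<close>

definition cderiv :: "'a \<Rightarrow> real" where
  "cderiv v = real_of_ereal (clarke_derivative F f v)"

lemma prod_not_bot: "F \<times>\<^sub>F at_right (0::real) \<noteq> bot"
  using F by (simp add: prod_filter_eq_bot)

lemma clarke_derivative_bounds:
  assumes "v \<in> S"
  shows "ereal (- p v) \<le> clarke_derivative F f v" "clarke_derivative F f v \<le> ereal (p v)"
proof -
  show "clarke_derivative F f v \<le> ereal (p v)"
    unfolding clarke_derivative_def
    by (rule Limsup_bounded, rule eventually_mono[OF bounded[OF assms]]) (auto simp del: abs_divide)
  show "ereal (- p v) \<le> clarke_derivative F f v"
    unfolding clarke_derivative_def
    by (rule le_Limsup[OF prod_not_bot], rule eventually_mono[OF bounded[OF assms]])
      (auto simp del: abs_divide)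
qed

lemma ereal_cderiv: "v \<in> S \<Longrightarrow> ereal (cderiv v) = clarke_derivative F f v"
  using clarke_derivative_bounds[of v] unfolding cderiv_def
  by (cases "clarke_derivative F f v") auto

lemma eventually_quotient_less:
  assumes "v \<in> S" "cderiv v < c"
  shows "\<forall>\<^sub>F (y, t) in F \<times>\<^sub>F at_right 0. (f (y + t *\<^sub>R v) - f y) / t < c"
proof -
  have "clarke_derivative F f v < ereal c"
    using assms by (simp flip: ereal_cderiv)
  then show ?thesis
    unfolding clarke_derivative_def
    by (rule eventually_mono[OF Limsup_lessD]) auto
qed

lemma cderiv_leI:
  assumes "v \<in> S" "\<And>c'. c < c' \<Longrightarrow> \<forall>\<^sub>F (y, t) in F \<times>\<^sub>F at_right 0. (f (y + t *\<^sub>R v) - f y) / t < c'"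
  shows "cderiv v \<le> c"
proof (rule dense_ge)
  fix c' assume "c < c'"
  have "clarke_derivative F f v \<le> ereal c'"
    unfolding clarke_derivative_def
    by (rule Limsup_bounded, rule eventually_mono[OF assms(2)[OF \<open>c < c'\<close>]]) auto
  then show "cderiv v \<le> c'" using \<open>v \<in> S\<close> by (simp flip: ereal_cderiv)
qed

lemma shift': "u \<in> S \<Longrightarrow>
    filterlim (\<lambda>(y, t). (y + t *\<^sub>R u, t)) (F \<times>\<^sub>F at_right 0) (F \<times>\<^sub>F at_right (0::real))"
  using filterlim_Pair[OF shift filterlim_snd] by (simp add: case_prod_beta')

lemma filterlim_scale_right:
  assumes "c > 0"
  shows "filterlim (\<lambda>(y, t). (y, c * t)) (F \<times>\<^sub>F at_right 0) (F \<times>\<^sub>F at_right (0::real))"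
proof -
  have "filterlim ((*) c) (at_right 0) (at_right 0)"
    unfolding filterlim_at
    using assms by (auto intro!: tendsto_eq_intros simp: eventually_at_right_field intro: exI[of _ 1])
  then have "filterlim (\<lambda>x. (fst x, c * snd x)) (F \<times>\<^sub>F at_right 0) (F \<times>\<^sub>F at_right 0)"
    by (intro filterlim_Pair filterlim_fst filterlim_compose[OF _ filterlim_snd])
  then show ?thesis by (simp add: case_prod_beta')
qed

text \<open>For a sum, the quotient is split at the intermediate point
  \<open>y + t *\<^sub>R u\<close>, and \<open>shift'\<close> moves the estimate for
  \<open>v\<close> to that base point. For a positive factor, \<open>t\<close> is replaced by
  \<open>c * t\<close>.\<close>

lemma sublinear_on_cderiv: "sublinear_on S cderiv"
  unfolding sublinear_on_def
proof (intro conjI ballI allI impI)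
  fix u v assume uv: "u \<in> S" "v \<in> S"
  show "cderiv (u + v) \<le> cderiv u + cderiv v"
  proof (rule cderiv_leI)
    fix c assume "cderiv u + cderiv v < c"
    define e where "e = (c - cderiv u - cderiv v) / 2"
    have e: "cderiv u < cderiv u + e" "cderiv v < cderiv v + e" "cderiv u + e + (cderiv v + e) = c"
      using \<open>cderiv u + cderiv v < c\<close> by (auto simp: e_def field_simps)
    have "\<forall>\<^sub>F (y, t) in F \<times>\<^sub>F at_right 0. (f (y + t *\<^sub>R u + t *\<^sub>R v) - f (y + t *\<^sub>R u)) / t < cderiv v + e"
      using eventually_compose_filterlim[OF eventually_quotient_less[OF uv(2) e(2)] shift'[OF uv(1)]]
      by (simp add: case_prod_beta')
    with eventually_quotient_less[OF uv(1) e(1)]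
    show "\<forall>\<^sub>F (y, t) in F \<times>\<^sub>F at_right 0. (f (y + t *\<^sub>R (u + v)) - f y) / t < c"
    proof eventually_elim
      case (elim x)
      then show ?case using e(3)
        by (auto simp: case_prod_beta' scaleR_add_right add.assoc diff_divide_distrib)
    qed
  qed (use uv S in \<open>simp add: subspace_add\<close>)
next
  fix c v assume c: "(c::real) > 0" and v: "v \<in> S"
  show "cderiv (c *\<^sub>R v) \<le> c * cderiv v"
  proof (rule cderiv_leI)
    fix c' assume "c * cderiv v < c'"
    then have fov: "cderiv v < c' / c" using c by (simp add: field_simps)
    have eq: "a / (c * t) < c' / c \<longleftrightarrow> a / t < c'" for a t
      using divide_less_cancel[of "a / t" c c'] c by (simp add: mult.commute)
    from eventually_compose_filterlim[OF eventually_quotient_less[OF v fov] filterlim_scale_right[OF c]]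
    show "\<forall>\<^sub>F (y, t) in F \<times>\<^sub>F at_right 0. (f (y + t *\<^sub>R c *\<^sub>R v) - f y) / t < c'"
      by (simp add: case_prod_beta' eq mult.commute[of _ c])
  qed (use v S in \<open>simp add: subspace_scale\<close>)
qed

lemma exists_subgradient_at:
  assumes "v \<in> S" "- cderiv (- v) \<le> c" "c \<le> cderiv v"
  shows "\<exists>\<zeta>\<in>algebraic_dual S. (\<forall>u\<in>S. ereal (\<zeta> u) \<le> clarke_derivative F f u) \<and> \<zeta> v = c"
  using linear_below_sublinear_at[OF sublinear_on_cderiv S assms]
  by (simp flip: ereal_cderiv cong: ball_cong)

text \<open>The upper bound on the derivative is used at \<open>v\<close> and at \<open>- v\<close>
  to control both signs. It later yields continuity of subgradients and a uniform bound on the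
  convex hull.\<close>

lemma subgradient_bound:
  assumes \<zeta>: "\<zeta> \<in> algebraic_dual S" and le: "\<And>u. u \<in> S \<Longrightarrow> ereal (\<zeta> u) \<le> clarke_derivative F f u"
    and v: "v \<in> S" and p: "p (- v) \<le> p v"
  shows "\<bar>\<zeta> v\<bar> \<le> p v"
proof -
  have "\<zeta> u \<le> p u" if "u \<in> S" for u
    using order_trans[OF le clarke_derivative_bounds(2)] that by simp
  from this[OF v] this[OF subspace_neg[OF S v]] show ?thesis
    using algebraic_dual_uminus[OF \<zeta> v] p by simp
qed

end

subsection \<open>The directional chain rule\<close>

text \<open>Restricting \<open>P\<close> to the points with \<open>R\<close> leaves a proper filter
  because \<open>R\<close> holds frequently, and compactness gives its image under \<open>Q\<close>
  a cluster point. The conclusion replaces extracting a convergent subsequence: anything eventually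
  true is realised together with \<open>R\<close> and with \<open>Q\<close> near
  \<open>q\<close>.\<close>

lemma cluster_point_along_frequently:
  fixes Q :: "'a \<Rightarrow> 'b::metric_space"
  assumes K: "compact K" and Q: "\<forall>\<^sub>F x in P. Q x \<in> K" and fr: "\<exists>\<^sub>F x in P. R x"
  obtains q where "\<And>E e. \<forall>\<^sub>F x in P. E x \<Longrightarrow> e > 0 \<Longrightarrow> \<exists>x. E x \<and> R x \<and> dist (Q x) q < e"
proof -
  define G where "G = inf P (principal {x. R x})"
  have "G \<noteq> bot"
    using fr by (auto simp: G_def trivial_limit_def eventually_inf_principal frequently_def)
  moreover have "\<forall>\<^sub>F w in filtermap Q G. w \<in> K"
    using Q by (auto simp: G_def eventually_filtermap eventually_inf_principal elim: eventually_mono)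
  ultimately obtain q where q: "inf (nhds q) (filtermap Q G) \<noteq> bot"
    using K unfolding compact_filter by (metis filtermap_bot_iff)
  show thesis
  proof (rule that, rule ccontr)
    fix E and e :: real
    assume E: "\<forall>\<^sub>F x in P. E x" and e: "e > 0" and no: "\<nexists>x. E x \<and> R x \<and> dist (Q x) q < e"
    have "\<forall>\<^sub>F w in nhds q. dist w q < e" using e eventually_nhds_metric by blast
    moreover have "\<forall>\<^sub>F w in filtermap Q G. \<not> dist w q < e"
      using E no by (auto simp: G_def eventually_filtermap eventually_inf_principal elim: eventually_mono)
    ultimately have "\<forall>\<^sub>F w in inf (nhds q) (filtermap Q G). False"
      unfolding eventually_inf by blast
    then show False using q by (simp add: trivial_limit_def)
  qed
qed

section \<open>Clarke subgradients of Lipschitz functions on Euclidean space\<close>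

lemma algebraic_dual_vec_inner:
  fixes \<zeta> :: "real ^ 'n \<Rightarrow> real"
  assumes "\<zeta> \<in> algebraic_dual UNIV"
  shows "\<zeta> w = (\<chi> i. \<zeta> (axis i 1)) \<bullet> w"
proof -
  have "linear \<zeta>"
    using assms by (intro linearI) (auto simp: algebraic_dual_def)
  then have "\<zeta> (\<Sum>i\<in>UNIV. w $ i *s axis i 1) = (\<Sum>i\<in>UNIV. w $ i * \<zeta> (axis i 1))"
    by (simp add: linear_sum scalar_mult_eq_scaleR linear_cmul)
  then show ?thesis
    by (simp add: basis_expansion inner_vec_def mult.commute)
qed

lemma clarke_setting_vec:
  fixes g :: "real ^ 'n \<Rightarrow> real"
  assumes "L-lipschitz_on UNIV g"
  shows "clarke_setting UNIV (nhds z) g (\<lambda>w. L * norm w)"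
proof
  show "filterlim (\<lambda>(y, t). y + t *\<^sub>R u) (nhds z) (nhds z \<times>\<^sub>F at_right 0)" for u
  proof -
    have "filterlim (\<lambda>x. snd x) (nhds 0) (nhds z \<times>\<^sub>F at_right (0::real))"
      using filterlim_snd filterlim_at[of snd] by blast
    then have "filterlim (\<lambda>x. fst x + snd x *\<^sub>R u) (nhds (z + 0 *\<^sub>R u)) (nhds z \<times>\<^sub>F at_right (0::real))"
      by (intro tendsto_intros filterlim_fst)
    then show ?thesis by (simp add: case_prod_beta')
  qed
  show "\<forall>\<^sub>F (y, t) in nhds z \<times>\<^sub>F at_right 0. \<bar>(g (y + t *\<^sub>R v) - g y) / t\<bar> \<le> L * norm v" for v
  proof -
    \<comment> \<open>At \<open>t = 0\<close> the quotient is 0 by the convention on division, so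
      the bound holds for every real \<open>t\<close>.\<close>
    have "\<bar>(g (y + t *\<^sub>R v) - g y) / t\<bar> \<le> L * norm v" for y and t :: real
      using lipschitz_onD[OF assms, of "y + t *\<^sub>R v" y]
      by (cases "t = 0") (auto simp: dist_norm field_simps lipschitz_on_nonneg[OF assms])
    then show ?thesis by (simp add: case_prod_beta' del: abs_divide)
  qed
qed auto

text \<open>The derivative itself is the largest value that may be prescribed in direction
  \<open>q\<close>, so the maximum of \<open>\<alpha> \<bullet> q\<close> over the subdifferential
  is attained.\<close>

lemma exists_clarke_subgradient_vec:
  fixes g :: "real ^ 'n \<Rightarrow> real"
  assumes "L-lipschitz_on UNIV g"
  obtains \<alpha> where "\<alpha> \<in> clarke_subdifferential g z" "clarke_derivative (nhds z) g q = ereal (\<alpha> \<bullet> q)"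
proof -
  interpret clarke_setting UNIV "nhds z" g "\<lambda>w. L * norm w" by (rule clarke_setting_vec[OF assms])
  have "- cderiv (- q) \<le> cderiv q" by (rule sublinear_on_ge_neg[OF sublinear_on_cderiv]) auto
  then obtain \<zeta> where \<zeta>: "\<zeta> \<in> algebraic_dual UNIV"
      "\<forall>u. ereal (\<zeta> u) \<le> clarke_derivative (nhds z) g u" "\<zeta> q = cderiv q"
    using exists_subgradient_at[of q "cderiv q"] by auto
  show thesis
    using \<zeta> by (intro that[of "\<chi> i. \<zeta> (axis i 1)"])
      (auto simp: clarke_subdifferential_def ereal_cderiv simp flip: algebraic_dual_vec_inner[OF \<zeta>(1)])
qed

text \<open>Both signs are obtained by testing with a standard basis vector and its negative, which
  have norm 1.\<close>

lemma clarke_subdifferential_component_le: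
  fixes g :: "real ^ 'n \<Rightarrow> real"
  assumes L: "L-lipschitz_on UNIV g" and \<alpha>: "\<alpha> \<in> clarke_subdifferential g z"
  shows "\<bar>\<alpha> $ i\<bar> \<le> L"
proof -
  interpret clarke_setting UNIV "nhds z" g "\<lambda>w. L * norm w" by (rule clarke_setting_vec[OF L])
  have "\<alpha> \<bullet> w \<le> L * norm w" for w
    using \<alpha> clarke_derivative_bounds(2)[of w] unfolding clarke_subdifferential_def
    by (auto dest!: spec[of _ w] dest: order_trans)
  from this[of "axis i 1"] this[of "- axis i 1"] show ?thesis
    by (simp add: inner_axis abs_le_iff)
qed

text \<open>Here \<open>\<alpha>\<close> and \<open>\<zeta>\<close> may depend on \<open>v\<close>
  and \<open>s\<close>. This suffices, since the closed convex hull is recovered from its support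
  function one direction at a time.\<close>

lemma chain_rule_directional:
  fixes h :: "'a::real_vector \<Rightarrow> real ^ 'n" and g :: "real ^ 'n \<Rightarrow> real"
  assumes h: "\<And>i. clarke_setting S F (\<lambda>y. h y $ i) (p i)"
    and hz: "filterlim h (nhds z) F" and g: "L-lipschitz_on UNIV g"
    and v: "v \<in> S" and s: "ereal s < clarke_derivative F (g \<circ> h) v"
  obtains \<alpha> \<zeta> where "\<alpha> \<in> clarke_subdifferential g z"
    "\<And>i. \<zeta> i \<in> algebraic_dual S"
    "\<And>i u. u \<in> S \<Longrightarrow> ereal (\<zeta> i u) \<le> clarke_derivative F (\<lambda>y. h y $ i) u"
    "s \<le> (\<Sum>i\<in>UNIV. \<alpha> $ i * \<zeta> i v)"
proof -
  interpret g: clarke_setting UNIV "nhds z" g "\<lambda>w. L * norm w" by (rule clarke_setting_vec[OF g])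
  let ?P = "F \<times>\<^sub>F at_right (0::real)"
  define Q where "Q = (\<lambda>(y, t). (1 / t) *\<^sub>R (h (y + t *\<^sub>R v) - h y))"
  define R where "R = (\<lambda>(y, t). s < (g (h (y + t *\<^sub>R v)) - g (h y)) / t)"
  have Q_nth: "Q (y, t) $ i = (h (y + t *\<^sub>R v) $ i - h y $ i) / t" for y t i
    by (simp add: Q_def)
  have L: "L \<ge> 0" by (rule lipschitz_on_nonneg[OF g])
  have "\<forall>\<^sub>F x in ?P. \<forall>i. \<bar>Q x $ i\<bar> \<le> p i v"
    unfolding eventually_all_finite
    using clarke_setting.bounded[OF h v]
    by (auto intro!: eventually_all_finite simp: Q_nth case_prod_beta' Q_def elim: eventually_mono)
  then have "\<forall>\<^sub>F x in ?P. Q x \<in> cbox (\<chi> i. - p i v) (\<chi> i. p i v)"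
    by eventually_elim (auto simp: mem_box_cart abs_le_iff minus_le_iff)
  moreover have "\<exists>\<^sub>F x in ?P. R x"
  proof (rule ccontr)
    assume "\<not> (\<exists>\<^sub>F x in ?P. R x)"
    then have "clarke_derivative F (g \<circ> h) v \<le> ereal s"
      unfolding clarke_derivative_def frequently_def not_not
      by (intro Limsup_bounded) (auto simp: R_def elim: eventually_mono)
    then show False using s by simp
  qed
  ultimately obtain q where q: "\<And>E e. \<forall>\<^sub>F x in ?P. E x \<Longrightarrow> e > 0 \<Longrightarrow> \<exists>x. E x \<and> R x \<and> dist (Q x) q < e"
    using cluster_point_along_frequently[OF compact_cbox] by metis
  have "\<exists>\<zeta>\<in>algebraic_dual S. (\<forall>u\<in>S. ereal (\<zeta> u) \<le> clarke_derivative F (\<lambda>y. h y $ i) u) \<and> \<zeta> v = q $ i" for i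
  proof -
    interpret h: clarke_setting S F "\<lambda>y. h y $ i" "p i" by (rule h)
    have near: "\<bar>Q x $ i - q $ i\<bar> < e" if "dist (Q x) q < e" for x e
      using component_le_norm_cart[of "Q x - q" i] that by (simp add: dist_norm)
    have nv: "- v \<in> S" using v h.S by (simp add: subspace_neg)
    show ?thesis
    proof (rule h.exists_subgradient_at[OF v])
      show "q $ i \<le> h.cderiv v"
      proof (rule field_le_epsilon)
        fix e :: real assume "e > 0"
        then obtain y t where "Q (y, t) $ i < h.cderiv v + e / 2" "dist (Q (y, t)) q < e / 2"
          using q[OF h.eventually_quotient_less[OF v, of "h.cderiv v + e / 2"], of "e / 2"]
          by (auto simp: Q_nth)
        then show "q $ i \<le> h.cderiv v + e" using near[of "(y, t)" "e / 2"] by linarith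
      qed
      have "- q $ i \<le> h.cderiv (- v)"
      proof (rule field_le_epsilon)
        fix e :: real assume "e > 0"
        then have "h.cderiv (- v) < h.cderiv (- v) + e / 2" by simp
        \<comment> \<open>Seen from the moved base point \<open>y + t *\<^sub>R v\<close>, the
          quotient of the component in direction \<open>- v\<close> is the negative of the component
          of \<open>Q\<close>.\<close>
        then have "\<forall>\<^sub>F x in ?P. - (Q x $ i) < h.cderiv (- v) + e / 2"
          using eventually_compose_filterlim[OF h.eventually_quotient_less[OF nv] h.shift'[OF v]]
          by (simp add: case_prod_beta' Q_def minus_divide_left)
        with \<open>e > 0\<close> obtain x where "- Q x $ i < h.cderiv (- v) + e / 2" "dist (Q x) q < e / 2"
          using q[of "\<lambda>x. - (Q x $ i) < h.cderiv (- v) + e / 2" "e / 2"] half_gt_zero[OF \<open>e > 0\<close>] by blast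
        then show "- q $ i \<le> h.cderiv (- v) + e" using near[of x "e / 2"] by linarith
      qed
      then show "- h.cderiv (- v) \<le> q $ i" by simp
    qed
  qed
  then obtain \<zeta> where \<zeta>: "\<And>i. \<zeta> i \<in> algebraic_dual S"
    "\<And>i u. u \<in> S \<Longrightarrow> ereal (\<zeta> i u) \<le> clarke_derivative F (\<lambda>y. h y $ i) u" "\<And>i. \<zeta> i v = q $ i"
    by metis
  have "s \<le> g.cderiv q"
  proof (rule field_le_epsilon)
    fix e :: real assume e: "e > 0"
    \<comment> \<open>The distance \<open>d\<close> is chosen so that \<open>L * d\<close> is at
      most \<open>e / 2\<close>; adding 1 covers \<open>L = 0\<close>.\<close>
    define d where "d = e / 2 / (L + 1)"
    have d: "d > 0" "L * d \<le> e / 2"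
      using e L by (auto simp: d_def field_simps)
    \<comment> \<open>As \<open>h\<close> tends to \<open>z\<close> along \<open>F\<close>, the
      points \<open>h y\<close> are admissible base points for the derivative of \<open>g\<close> at
      \<open>z\<close>.\<close>
    have "filterlim (\<lambda>(y, t). (h y, t)) (nhds z \<times>\<^sub>F at_right 0) ?P"
      using filterlim_Pair[OF filterlim_compose[OF hz filterlim_fst] filterlim_snd]
      by (simp add: case_prod_beta')
    from eventually_compose_filterlim[OF g.eventually_quotient_less[of q "g.cderiv q + e / 2"] this] e
    have "\<forall>\<^sub>F x in ?P. (g (h (fst x) + snd x *\<^sub>R q) - g (h (fst x))) / snd x < g.cderiv q + e / 2"
      by (simp add: case_prod_beta')
    moreover have "\<forall>\<^sub>F x in ?P. snd x > 0"
      by (rule eventually_compose_filterlim[OF eventually_at_right_less filterlim_snd])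
    ultimately have "\<forall>\<^sub>F x in ?P. (g (h (fst x) + snd x *\<^sub>R q) - g (h (fst x))) / snd x < g.cderiv q + e / 2 \<and> snd x > 0"
      by (rule eventually_conj)
    from q[OF this d(1)] obtain y t where yt: "(g (h y + t *\<^sub>R q) - g (h y)) / t < g.cderiv q + e / 2" "t > 0"
      "R (y, t)" "dist (Q (y, t)) q < d" by auto
    \<comment> \<open>Since \<open>t > 0\<close>, the increment of \<open>h\<close> is exactly
      \<open>t\<close> times \<open>Q (y, t)\<close>. The Lipschitz property then allows
      \<open>q\<close> in place of \<open>Q (y, t)\<close> at a cost of \<open>e / 2\<close> in the
      quotient of \<open>g\<close>.\<close>
    have eq: "h (y + t *\<^sub>R v) = h y + t *\<^sub>R Q (y, t)" using yt by (simp add: Q_def)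
    have "g (h y + t *\<^sub>R Q (y, t)) - g (h y + t *\<^sub>R q) \<le> L * dist (h y + t *\<^sub>R Q (y, t)) (h y + t *\<^sub>R q)"
      using lipschitz_onD[OF g, of "h y + t *\<^sub>R Q (y, t)" "h y + t *\<^sub>R q"] by (simp add: dist_real_def)
    also have "\<dots> = L * dist (Q (y, t)) q * t"
      using yt by (simp add: dist_norm flip: scaleR_diff_right)
    also have "\<dots> \<le> (e / 2) * t"
    proof (rule mult_right_mono)
      have "L * dist (Q (y, t)) q \<le> L * d" using yt L by (intro mult_left_mono) auto
      then show "L * dist (Q (y, t)) q \<le> e / 2" using d by simp
    qed (use yt in simp)
    finally have "(g (h y + t *\<^sub>R Q (y, t)) - g (h y)) / t \<le> (g (h y + t *\<^sub>R q) - g (h y)) / t + e / 2"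
      using yt by (simp add: field_simps)
    then show "s \<le> g.cderiv q + e" using yt by (simp add: R_def eq)
  qed
  moreover obtain \<alpha> where \<alpha>: "\<alpha> \<in> clarke_subdifferential g z" "clarke_derivative (nhds z) g q = ereal (\<alpha> \<bullet> q)"
    by (rule exists_clarke_subgradient_vec[OF g])
  then have "g.cderiv q = (\<Sum>i\<in>UNIV. \<alpha> $ i * \<zeta> i v)"
    by (simp add: g.cderiv_def \<zeta>(3) inner_vec_def)
  ultimately show thesis using that[OF \<alpha>(1) \<zeta>(1,2)] by simp
qed

subsection \<open>The Minkowski functional of a symmetric convex set\<close>

locale symmetric_convex =
  fixes C :: "'a::real_vector set" and x0 :: 'a
  assumes convex: "convex C" and x0: "x0 \<in> C" and symmetric: "symmetric_wrt C x0"
begin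

abbreviation K where "K \<equiv> translate_to_origin C x0"
abbreviation S where "S \<equiv> dir_space C x0"
abbreviation \<mu> where "\<mu> \<equiv> minkowski C x0"

lemma convex_K: "convex K"
  using convex by (simp add: translate_to_origin_def)

lemma zero_K: "0 \<in> K"
  using x0 by (force simp: translate_to_origin_def)

lemma uminus_K: "c \<in> K \<Longrightarrow> - c \<in> K"
  using symmetric by (auto simp: symmetric_wrt_def)

lemma subspace_S: "subspace S"
  by (simp add: dir_space_def subspace_span)

text \<open>Convexity in the form \<open>s K + t K \<subseteq> (s + t) K\<close>, behind both the
  description of the span and the subadditivity of \<open>\<mu>\<close>.\<close>

lemma combine_K:
  assumes "c \<in> K" "d \<in> K" "s \<ge> 0" "t \<ge> 0" "s + t > 0"
  obtains k where "k \<in> K" "s *\<^sub>R c + t *\<^sub>R d = (s + t) *\<^sub>R k"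
proof
  show "(s / (s + t)) *\<^sub>R c + (t / (s + t)) *\<^sub>R d \<in> K"
    using assms by (intro convexD[OF convex_K]) (auto simp flip: add_divide_distrib)
  show "s *\<^sub>R c + t *\<^sub>R d = (s + t) *\<^sub>R ((s / (s + t)) *\<^sub>R c + (t / (s + t)) *\<^sub>R d)"
    using assms by (simp add: scaleR_add_right)
qed

text \<open>Symmetry absorbs the sign of \<open>r\<close>.\<close>

lemma scale_K:
  assumes "c \<in> K" "t > 0"
  obtains d where "d \<in> K" "r *\<^sub>R t *\<^sub>R c = (\<bar>r\<bar> * t) *\<^sub>R d"
proof (cases "r \<ge> 0")
  case True
  then show thesis using assms by (intro that[of c]) auto
next
  case False
  then show thesis using assms uminus_K by (intro that[of "- c"]) auto
qed

text \<open>By convexity and symmetry the positive multiples of points of \<open>K\<close> form a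
  subspace, which therefore contains the span. Hence the infimum defining \<open>\<mu>\<close> is
  over a nonempty set on all of \<open>S\<close>.\<close>

lemma absorbing:
  assumes "v \<in> S"
  shows "\<exists>t>0. \<exists>c\<in>K. v = t *\<^sub>R c"
proof -
  let ?U = "{v. \<exists>t>0. \<exists>c\<in>K. v = t *\<^sub>R c}"
  have "subspace ?U"
  proof (rule subspaceI)
    show "0 \<in> ?U" using zero_K by (auto intro!: exI[of _ "1::real"] bexI[of _ 0])
  next
    fix u v assume "u \<in> ?U" "v \<in> ?U"
    then obtain s c t d where *: "s > 0" "c \<in> K" "u = s *\<^sub>R c" "t > 0" "d \<in> K" "v = t *\<^sub>R d" by blast
    then obtain k where "k \<in> K" "s *\<^sub>R c + t *\<^sub>R d = (s + t) *\<^sub>R k"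
      by (metis combine_K add_pos_pos less_imp_le)
    then show "u + v \<in> ?U" using * by (auto intro!: exI[of _ "s + t"])
  next
    fix r v assume "v \<in> ?U"
    then obtain t c where *: "t > 0" "c \<in> K" "v = t *\<^sub>R c" by blast
    show "r *\<^sub>R v \<in> ?U"
    proof (cases "r = 0")
      case True
      then show ?thesis using zero_K by (auto intro!: exI[of _ "1::real"] bexI[of _ 0])
    next
      case False
      obtain d where "d \<in> K" "r *\<^sub>R t *\<^sub>R c = (\<bar>r\<bar> * t) *\<^sub>R d" using scale_K[OF *(2,1)] .
      then show ?thesis using * False by (auto intro!: exI[of _ "\<bar>r\<bar> * t"])
    qed
  qed
  moreover have "K \<subseteq> ?U" by (auto intro!: exI[of _ "1::real"])
  ultimately show ?thesis using span_minimal assms unfolding dir_space_def by blast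
qed

lemma minkowski_le:
  assumes "c \<in> K" "t > 0"
  shows "\<mu> (t *\<^sub>R c) \<le> t"
  unfolding minkowski_def using assms
  by (intro cInf_lower) (auto intro: bdd_belowI[of _ 0])

lemma minkowski_lessD:
  assumes "v \<in> S" "\<mu> v < r"
  obtains t c where "0 < t" "t < r" "c \<in> K" "v = t *\<^sub>R c"
proof -
  have "{t. t > 0 \<and> v \<in> (\<lambda>c. t *\<^sub>R c) ` K} \<noteq> {}" using absorbing[OF assms(1)] by blast
  from cInf_lessD[OF this] assms(2) that show thesis unfolding minkowski_def by blast
qed

lemma minkowski_nonneg: "v \<in> S \<Longrightarrow> \<mu> v \<ge> 0"
  unfolding minkowski_def using absorbing[of v] by (intro cInf_greatest) auto

lemma minkowski_add_le:
  assumes "u \<in> S" "v \<in> S"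
  shows "\<mu> (u + v) \<le> \<mu> u + \<mu> v"
proof (rule field_le_epsilon)
  fix e :: real assume "e > 0"
  then obtain s c t d where *: "0 < s" "s < \<mu> u + e / 2" "c \<in> K" "u = s *\<^sub>R c"
    "0 < t" "t < \<mu> v + e / 2" "d \<in> K" "v = t *\<^sub>R d"
    using minkowski_lessD[OF assms(1), of "\<mu> u + e / 2"] minkowski_lessD[OF assms(2), of "\<mu> v + e / 2"]
    by (metis half_gt_zero less_add_same_cancel1)
  then obtain k where "k \<in> K" "s *\<^sub>R c + t *\<^sub>R d = (s + t) *\<^sub>R k"
    by (metis combine_K add_pos_pos less_imp_le)
  then have "\<mu> (u + v) \<le> s + t" using * minkowski_le[of k "s + t"] by simp
  then show "\<mu> (u + v) \<le> \<mu> u + \<mu> v + e" using * by linarith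
qed

lemma minkowski_zero: "\<mu> 0 = 0"
proof (rule antisym)
  show "\<mu> 0 \<le> 0"
    by (rule field_le_epsilon) (use minkowski_le[OF zero_K] in simp)
qed (simp add: minkowski_nonneg subspace_0[OF subspace_S])

lemma minkowski_scale_le:
  assumes "v \<in> S"
  shows "\<mu> (r *\<^sub>R v) \<le> \<bar>r\<bar> * \<mu> v"
proof (cases "r = 0")
  case True
  then show ?thesis by (simp add: minkowski_zero)
next
  case False
  have "\<mu> (r *\<^sub>R v) / \<bar>r\<bar> \<le> \<mu> v"
  proof (rule dense_ge)
    fix s assume "\<mu> v < s"
    then obtain t c where *: "0 < t" "t < s" "c \<in> K" "v = t *\<^sub>R c"
      using minkowski_lessD[OF assms] by metis
    obtain d where "d \<in> K" "r *\<^sub>R t *\<^sub>R c = (\<bar>r\<bar> * t) *\<^sub>R d" using scale_K[OF *(3,1)] .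
    then have "\<mu> (r *\<^sub>R v) \<le> \<bar>r\<bar> * t"
      using minkowski_le[of d "\<bar>r\<bar> * t"] * False by simp
    also have "\<dots> \<le> \<bar>r\<bar> * s" using * by (intro mult_left_mono) auto
    finally show "\<mu> (r *\<^sub>R v) / \<bar>r\<bar> \<le> s" using False by (simp add: field_simps)
  qed
  then show ?thesis using False by (simp add: field_simps)
qed

lemma minkowski_uminus_le: "v \<in> S \<Longrightarrow> \<mu> (- v) \<le> \<mu> v"
  using minkowski_scale_le[of v "- 1"] by simp

text \<open>With \<open>t < 1\<close>, the point \<open>t *\<^sub>R c\<close> is a convex
  combination of \<open>c\<close> and \<open>0\<close>, both in \<open>K\<close>.\<close>

lemma minkowski_ball_subset: "minkowski_ball C x0 1 \<subseteq> C"
proof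
  fix x assume "x \<in> minkowski_ball C x0 1"
  then obtain t c where *: "0 < t" "t < 1" "c \<in> K" "x - x0 = t *\<^sub>R c"
    unfolding minkowski_ball_def by (auto elim: minkowski_lessD)
  have "t *\<^sub>R c + (1 - t) *\<^sub>R 0 \<in> K"
    using * zero_K by (intro convexD[OF convex_K]) auto
  then have "x - x0 \<in> K" using * by simp
  then show "x \<in> C" by (auto simp: translate_to_origin_def)
qed

section \<open>Neighbourhoods for the Minkowski seminorm and Lipschitz functions\<close>

lemma eventually_minkowski_nhds:
  "(\<forall>\<^sub>F y in minkowski_nhds C x0 x. P y) \<longleftrightarrow> (\<exists>e>0. \<forall>y. y - x \<in> S \<longrightarrow> \<mu> (y - x) < e \<longrightarrow> P y)"
  (is "?l = ?r")
proof
  assume ?l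
  then obtain R where R: "\<forall>\<^sub>F r in nhds 0. R r" "\<And>y. R (\<mu> (y - x)) \<Longrightarrow> y - x \<in> S \<Longrightarrow> P y"
    by (auto simp: minkowski_nhds_def eventually_inf_principal eventually_filtercomap)
  then obtain e where e: "e > 0" "\<And>r. \<bar>r\<bar> < e \<Longrightarrow> R r"
    by (auto simp: eventually_nhds_metric)
  then show ?r using R(2) minkowski_nonneg by (intro exI[of _ e]) auto
next
  assume ?r
  then obtain e where e: "e > 0" "\<And>y. y - x \<in> S \<Longrightarrow> \<mu> (y - x) < e \<Longrightarrow> P y" by blast
  then show ?l
    unfolding minkowski_nhds_def eventually_inf_principal eventually_filtercomap eventually_nhds_metric
    by (intro exI[of _ "\<lambda>r. r < e"]) auto
qed

lemma eventually_dir_space: "\<forall>\<^sub>F y in minkowski_nhds C x0 x. y - x \<in> S"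
  by (auto simp: eventually_minkowski_nhds intro: exI[of _ "1::real"])

lemma tendsto_minkowski: "((\<lambda>y. \<mu> (y - x)) \<longlongrightarrow> 0) (minkowski_nhds C x0 x)"
  unfolding minkowski_nhds_def
  by (rule filterlim_mono[OF filterlim_filtercomap order_refl inf_le1])

lemma filterlim_minkowski_nhds:
  assumes "\<forall>\<^sub>F a in G. X a - x \<in> S" "((\<lambda>a. \<mu> (X a - x)) \<longlongrightarrow> 0) G"
  shows "filterlim X (minkowski_nhds C x0 x) G"
  using assms
  by (simp add: minkowski_nhds_def filterlim_inf filterlim_principal filterlim_filtercomap_iff o_def)

text \<open>By the triangle inequality the \<open>\<mu>\<close>-ball of radius
  \<open>1 - \<mu> (x - x0)\<close> around \<open>x\<close> stays in the unit ball around
  \<open>x0\<close>.\<close>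

lemma eventually_in_C:
  assumes "x \<in> minkowski_ball C x0 1"
  shows "\<forall>\<^sub>F y in minkowski_nhds C x0 x. y \<in> C"
proof -
  have x: "x - x0 \<in> S" "\<mu> (x - x0) < 1" using assms by (auto simp: minkowski_ball_def)
  have "y \<in> C" if y: "y - x \<in> S" "\<mu> (y - x) < 1 - \<mu> (x - x0)" for y
  proof -
    have "y - x0 \<in> S" "\<mu> (y - x0) < 1"
      using subspace_add[OF subspace_S y(1) x(1)] minkowski_add_le[OF y(1) x(1)] y by simp_all
    then show ?thesis using minkowski_ball_subset by (auto simp: minkowski_ball_def)
  qed
  then show ?thesis
    unfolding eventually_minkowski_nhds using x by (intro exI[of _ "1 - \<mu> (x - x0)"]) auto
qed

text \<open>The distance of the shifted point from \<open>x\<close> is squeezed by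
  \<open>\<mu> (y - x) + \<bar>t\<bar> * \<mu> u\<close>, which tends to 0.\<close>

lemma filterlim_shift_minkowski:
  assumes u: "u \<in> S"
  shows "filterlim (\<lambda>(y, t). y + t *\<^sub>R u) (minkowski_nhds C x0 x) (minkowski_nhds C x0 x \<times>\<^sub>F at_right 0)"
proof (rule filterlim_minkowski_nhds)
  let ?N = "minkowski_nhds C x0 x" and ?P = "minkowski_nhds C x0 x \<times>\<^sub>F at_right (0::real)"
  have ev: "\<forall>\<^sub>F a in ?P. fst a - x \<in> S"
    by (rule eventually_compose_filterlim[OF eventually_dir_space filterlim_fst])
  then show "\<forall>\<^sub>F a in ?P. (case a of (y, t) \<Rightarrow> y + t *\<^sub>R u) - x \<in> S"
  proof eventually_elim
    case (elim a)
    show ?case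
      using subspace_add[OF subspace_S elim subspace_scale[OF subspace_S u, of "snd a"]]
      by (simp add: case_prod_beta' algebra_simps)
  qed
  have "\<forall>\<^sub>F a in ?P. norm (\<mu> ((case a of (y, t) \<Rightarrow> y + t *\<^sub>R u) - x)) \<le> \<mu> (fst a - x) + \<bar>snd a\<bar> * \<mu> u"
    using ev
  proof eventually_elim
    case (elim a)
    have su: "snd a *\<^sub>R u \<in> S" by (rule subspace_scale[OF subspace_S u])
    have eq: "fst a + snd a *\<^sub>R u - x = (fst a - x) + snd a *\<^sub>R u" by simp
    show ?case
      using minkowski_add_le[OF elim su] minkowski_scale_le[OF u, of "snd a"]
        minkowski_nonneg[OF subspace_add[OF subspace_S elim su]]
      unfolding case_prod_beta' eq by simp
  qed
  moreover have "((\<lambda>a. \<mu> (fst a - x) + \<bar>snd a\<bar> * \<mu> u) \<longlongrightarrow> 0 + \<bar>0\<bar> * \<mu> u) ?P"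
  proof (intro tendsto_intros)
    show "((\<lambda>a. \<mu> (fst a - x)) \<longlongrightarrow> 0) ?P"
      by (rule filterlim_compose[OF tendsto_minkowski filterlim_fst])
    show "(snd \<longlongrightarrow> 0) ?P"
      using filterlim_snd filterlim_at[of snd] by blast
  qed
  then have "((\<lambda>a. \<mu> (fst a - x) + \<bar>snd a\<bar> * \<mu> u) \<longlongrightarrow> 0) ?P" by simp
  ultimately show "((\<lambda>a. \<mu> ((case a of (y, t) \<Rightarrow> y + t *\<^sub>R u) - x)) \<longlongrightarrow> 0) ?P"
    by (rule Lim_null_comparison)
qed

text \<open>Both \<open>y\<close> and \<open>y + t *\<^sub>R v\<close> eventually lie in
  \<open>C\<close>, where the Lipschitz estimate is available.\<close>

lemma clarke_setting_minkowski:
  assumes x: "x \<in> minkowski_ball C x0 1" and L: "L \<ge> 0"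
    and f: "\<And>y z. y \<in> C \<Longrightarrow> z \<in> C \<Longrightarrow> \<bar>f y - f z\<bar> \<le> L * \<mu> (y - z)"
  shows "clarke_setting S (minkowski_nhds C x0 x) f (\<lambda>v. L * \<mu> v)"
proof
  show "subspace S" by (rule subspace_S)
  \<comment> \<open>The filter is proper because \<open>x\<close> itself lies in each of its
    neighbourhoods.\<close>
  show "minkowski_nhds C x0 x \<noteq> bot"
    unfolding trivial_limit_def eventually_minkowski_nhds
    by (auto intro!: exI[of _ x] simp: minkowski_zero subspace_0[OF subspace_S])
  show "filterlim (\<lambda>(y, t). y + t *\<^sub>R u) (minkowski_nhds C x0 x) (minkowski_nhds C x0 x \<times>\<^sub>F at_right 0)"
    if "u \<in> S" for u using that by (rule filterlim_shift_minkowski)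
  show "\<forall>\<^sub>F (y, t) in minkowski_nhds C x0 x \<times>\<^sub>F at_right 0. \<bar>(f (y + t *\<^sub>R v) - f y) / t\<bar> \<le> L * \<mu> v"
    if v: "v \<in> S" for v
  proof -
    let ?P = "minkowski_nhds C x0 x \<times>\<^sub>F at_right (0::real)"
    have "\<forall>\<^sub>F a in ?P. fst a \<in> C"
      by (rule eventually_compose_filterlim[OF eventually_in_C[OF x] filterlim_fst])
    moreover have "\<forall>\<^sub>F a in ?P. fst a + snd a *\<^sub>R v \<in> C"
      using eventually_compose_filterlim[OF eventually_in_C[OF x] filterlim_shift_minkowski[OF v]]
      by (simp add: case_prod_beta')
    moreover have "\<forall>\<^sub>F a in ?P. snd a > 0"
      by (rule eventually_compose_filterlim[OF eventually_at_right_less filterlim_snd])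
    ultimately show ?thesis
    proof eventually_elim
      case (elim a)
      have "\<bar>f (fst a + snd a *\<^sub>R v) - f (fst a)\<bar> \<le> L * \<mu> (snd a *\<^sub>R v)"
        using f[OF elim(2,1)] by simp
      also have "\<dots> \<le> L * (snd a * \<mu> v)"
        using minkowski_scale_le[OF v, of "snd a"] elim L by (intro mult_left_mono) auto
      finally show ?case using elim by (simp add: case_prod_beta' field_simps)
    qed
  qed
qed

lemma filterlim_minkowski_lipschitz:
  fixes h :: "'a \<Rightarrow> real ^ 'n"
  assumes x: "x \<in> minkowski_ball C x0 1"
    and h: "\<And>i y z. y \<in> C \<Longrightarrow> z \<in> C \<Longrightarrow> \<bar>h y $ i - h z $ i\<bar> \<le> L i * \<mu> (y - z)"
  shows "filterlim h (nhds (h x)) (minkowski_nhds C x0 x)"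
proof (rule vec_tendstoI)
  fix i
  have "\<forall>\<^sub>F y in minkowski_nhds C x0 x. norm (h y $ i - h x $ i) \<le> L i * \<mu> (y - x)"
    using eventually_in_C[OF x] h minkowski_ball_subset x by (auto elim!: eventually_mono)
  moreover have "((\<lambda>y. L i * \<mu> (y - x)) \<longlongrightarrow> 0) (minkowski_nhds C x0 x)"
    using tendsto_mult_right_zero[OF tendsto_minkowski] .
  ultimately have "((\<lambda>y. h y $ i - h x $ i) \<longlongrightarrow> 0) (minkowski_nhds C x0 x)"
    by (rule Lim_null_comparison)
  then show "((\<lambda>y. h y $ i) \<longlongrightarrow> h x $ i) (minkowski_nhds C x0 x)"
    by (simp add: LIM_zero_iff)
qed

text \<open>Translation by \<open>- u\<close> is continuous for \<open>T\<close>, so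
  \<open>\<mu> (v - u)\<close> tends to 0 as \<open>v\<close> tends to \<open>u\<close>; up to the
  factor \<open>M\<close> it dominates the increment of \<open>\<zeta>\<close>.\<close>

lemma bounded_in_topological_dual:
  assumes T: "vector_topology_on S T" and cont: "continuous_map T euclideanreal \<mu>"
    and \<zeta>: "\<zeta> \<in> algebraic_dual S" and bound: "\<And>v. v \<in> S \<Longrightarrow> \<bar>\<zeta> v\<bar> \<le> M * \<mu> v"
  shows "\<zeta> \<in> topological_dual T"
proof -
  have top: "topspace T = S" and add: "continuous_map (prod_topology T T) T (\<lambda>(u, v). u + v)"
    using T by (auto simp: vector_topology_on_def)
  have "(\<zeta> \<longlongrightarrow> \<zeta> u) (atin T u)" if u: "u \<in> S" for u
  proof -
    have "continuous_map T (prod_topology T T) (\<lambda>v. (v, - u))"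
      using u top subspace_neg[OF subspace_S u] by (intro continuous_map_pairedI) auto
    from continuous_map_compose[OF continuous_map_compose[OF this add] cont]
    have "continuous_map T euclideanreal (\<lambda>v. \<mu> (v - u))" by (simp add: o_def)
    then have "((\<lambda>v. \<mu> (v - u)) \<longlongrightarrow> 0) (atin T u)"
      using u top minkowski_zero by (auto simp: continuous_map_atin)
    then have "((\<lambda>v. M * \<mu> (v - u)) \<longlongrightarrow> 0) (atin T u)" by (rule tendsto_mult_right_zero)
    moreover have "\<forall>\<^sub>F v in atin T u. norm (\<zeta> v - \<zeta> u) \<le> M * \<mu> (v - u)"
    proof -
      have "norm (\<zeta> v - \<zeta> u) \<le> M * \<mu> (v - u)" if v: "v \<in> S" for v
        using algebraic_dualD(1)[OF \<zeta> v subspace_neg[OF subspace_S u]]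
          algebraic_dual_uminus[OF \<zeta> u] bound[OF subspace_diff[OF subspace_S v u]] by simp
      then show ?thesis
        using top by (auto simp: eventually_atin intro!: exI[of _ "topspace T"])
    qed
    ultimately have "((\<lambda>v. \<zeta> v - \<zeta> u) \<longlongrightarrow> 0) (atin T u)"
      by (rule Lim_null_comparison[rotated])
    then show ?thesis by (simp add: LIM_zero_iff)
  qed
  then show ?thesis using \<zeta> top by (simp add: topological_dual_def continuous_map_atin)
qed

end

subsection \<open>Closed convex hulls of functionals\<close>

lemma algebraic_dual_sum:
  assumes \<zeta>: "\<zeta> \<in> algebraic_dual S" and S: "subspace S" and J: "finite J" "J \<subseteq> S"
  shows "\<zeta> (\<Sum>j\<in>J. c j *\<^sub>R j) = (\<Sum>j\<in>J. c j * \<zeta> j)"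
  using J
proof (induction J rule: finite_induct)
  case empty
  then show ?case using algebraic_dualD(2)[OF \<zeta> subspace_0[OF S], of 0] by simp
next
  case (insert j J)
  have j: "j \<in> S" and "(\<Sum>j\<in>J. c j *\<^sub>R j) \<in> S"
    using insert.prems by (auto intro: subspace_sum[OF S] subspace_scale[OF S])
  then show ?case
    using insert algebraic_dualD(1)[OF \<zeta> subspace_scale[OF S j]] algebraic_dualD(2)[OF \<zeta> j] by simp
qed

text \<open>Along the segment from \<open>a\<close> to \<open>b\<close> the squared distance to
  \<open>z\<close> is quadratic in \<open>r\<close>; its linear term tells whether moving towards
  \<open>b\<close> brings \<open>z\<close> nearer.\<close>

lemma sum_square_convex_combination:
  fixes a b z :: "'a \<Rightarrow> real"
  shows "(\<Sum>j\<in>J. ((1 - r) * a j + r * b j - z j)\<^sup>2)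
    = (\<Sum>j\<in>J. (a j - z j)\<^sup>2) + 2 * r * (\<Sum>j\<in>J. (a j - z j) * (b j - a j)) + r\<^sup>2 * (\<Sum>j\<in>J. (b j - a j)\<^sup>2)"
proof -
  have "((1 - r) * a j + r * b j - z j)\<^sup>2
      = (a j - z j)\<^sup>2 + 2 * r * ((a j - z j) * (b j - a j)) + r\<^sup>2 * (b j - a j)\<^sup>2" for j
    by (simp add: power2_eq_square algebra_simps)
  then show ?thesis by (simp add: sum.distrib sum_distrib_left)
qed

text \<open>A Hahn--Banach separation argument in the coordinates \<open>J\<close>, carried out by hand: if \<open>z\<close> stays
  away from \<open>H\<close>, then \<open>z - a\<close>, for an almost nearest point \<open>a \<in> H\<close>, separates.\<close>

lemma approximate_by_support:
  assumes S: "subspace S" and J: "finite J" "J \<subseteq> S"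
    and H: "convex_functionals S H" "H \<subseteq> algebraic_dual S" "\<And>a v. a \<in> H \<Longrightarrow> v \<in> S \<Longrightarrow> \<bar>a v\<bar> \<le> P v"
    and z: "z \<in> algebraic_dual S" and support: "\<And>w r. w \<in> S \<Longrightarrow> r < z w \<Longrightarrow> \<exists>b\<in>H. r \<le> b w"
    and e: "e > 0"
  shows "\<exists>a\<in>H. \<forall>j\<in>J. \<bar>a j - z j\<bar> < e"
proof (rule ccontr)
  assume no: "\<not> ?thesis"
  define D where "D = (\<lambda>a. \<Sum>j\<in>J. (a j - z j)\<^sup>2)"
  define m where "m = (INF a\<in>H. D a)"
  \<comment> \<open>All members of \<open>H\<close> are bounded by \<open>P\<close>, so
    \<open>M\<close> bounds the squared distance between any two of them in the coordinates
    \<open>J\<close>.\<close>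
  define M where "M = (\<Sum>j\<in>J. (2 * P j)\<^sup>2)"
  \<comment> \<open>The step length is at most 1, to stay on a segment, and small enough for
    \<open>r * M \<le> e\<^sup>2 / 2\<close>; adding 1 covers \<open>M = 0\<close>.\<close>
  define r where "r = min 1 (e\<^sup>2 / (2 * (M + 1)))"
  have M: "M \<ge> 0" by (simp add: M_def sum_nonneg)
  have e2: "e\<^sup>2 > 0" using e by simp
  have r: "0 < r" "r \<le> 1" using M e2 by (auto simp: r_def)
  have rM: "r * M \<le> e\<^sup>2 / 2"
  proof -
    have "r * M \<le> e\<^sup>2 / (2 * (M + 1)) * (M + 1)"
      using M r by (intro mult_mono) (auto simp: r_def)
    also have "\<dots> = e\<^sup>2 / 2" using M by (simp add: divide_simps)
    finally show ?thesis .
  qed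
  have D_ge: "e\<^sup>2 \<le> D a" if "a \<in> H" for a
  proof -
    obtain j where j: "j \<in> J" "\<bar>a j - z j\<bar> \<ge> e" using no \<open>a \<in> H\<close> by force
    then have "e\<^sup>2 \<le> (a j - z j)\<^sup>2" using e by (metis abs_le_square_iff abs_of_pos)
    also have "\<dots> \<le> D a" unfolding D_def using j J by (intro member_le_sum) auto
    finally show ?thesis .
  qed
  \<comment> \<open>The support condition at \<open>0\<close>, with a number below
    \<open>z 0\<close>, already provides a member of \<open>H\<close>.\<close>
  have ne: "H \<noteq> {}"
    using support[OF subspace_0[OF S], of "z 0 - 1"] by auto
  have bdd: "bdd_below (D ` H)" by (intro bdd_belowI2[of _ 0]) (simp add: D_def sum_nonneg)
  have "m < m + r * (e\<^sup>2 / 2)" using r e2 by simp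
  then obtain a where a: "a \<in> H" "D a < m + r * (e\<^sup>2 / 2)"
    unfolding m_def using cINF_less_iff[OF ne bdd] by blast
  \<comment> \<open>The coordinates of \<open>z - a\<close> serve as coefficients, so that linearity
    turns \<open>z w - b w\<close> into an inner product with \<open>z - a\<close>.\<close>
  define w where "w = (\<Sum>j\<in>J. (z j - a j) *\<^sub>R j)"
  have w: "w \<in> S" unfolding w_def using J S by (intro subspace_sum subspace_scale) auto
  have "z w - e\<^sup>2 / 4 < z w" using e2 by simp
  then obtain b where b: "b \<in> H" "z w - e\<^sup>2 / 4 \<le> b w" using support[OF w] by blast
  define X where "X = (\<Sum>j\<in>J. (a j - z j) * (b j - a j))"
  define N where "N = (\<Sum>j\<in>J. (b j - a j)\<^sup>2)"
  have "N \<le> M"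
    unfolding N_def M_def
  proof (rule sum_mono)
    fix j assume "j \<in> J"
    then have "\<bar>b j - a j\<bar> \<le> 2 * P j"
      using H(3)[OF a(1), of j] H(3)[OF b(1), of j] J by auto
    then show "(b j - a j)\<^sup>2 \<le> (2 * P j)\<^sup>2" by (metis abs_le_square_iff abs_ge_self order_trans)
  qed
  let ?c = "\<lambda>v\<in>S. (1 - r) * a v + r * b v"
  have "?c \<in> H" using H(1) a(1) b(1) r unfolding convex_functionals_def by simp
  then have "m \<le> D ?c" unfolding m_def by (rule cINF_lower[OF bdd])
  also have "D ?c = D a + 2 * r * X + r\<^sup>2 * N"
  proof -
    have "D ?c = (\<Sum>j\<in>J. ((1 - r) * a j + r * b j - z j)\<^sup>2)"
      unfolding D_def using J by (intro sum.cong) auto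
    then show ?thesis by (simp add: sum_square_convex_combination D_def X_def N_def)
  qed
  also have "r\<^sup>2 * N \<le> r\<^sup>2 * M" using \<open>N \<le> M\<close> by (intro mult_left_mono) auto
  \<comment> \<open>The step towards \<open>b\<close> cannot take \<open>D\<close> below
    \<open>m\<close>, while \<open>D a\<close> exceeds \<open>m\<close> by less than
    \<open>r * (e\<^sup>2 / 2)\<close>. Cancelling \<open>r\<close> bounds \<open>X\<close> from
    below.\<close>
  finally have "r * 0 < r * (e\<^sup>2 / 2 + 2 * X + r * M)"
    using a(2) by (simp add: algebra_simps power2_eq_square)
  then have X: "0 < e\<^sup>2 / 2 + 2 * X + r * M" using r by (simp only: mult_less_cancel_left_pos)
  have "z w - b w = D a + X"
  proof -
    have "z w - b w = (\<Sum>j\<in>J. (z j - a j) * (z j - b j))"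
      using algebraic_dual_sum[OF z S J] algebraic_dual_sum[OF subsetD[OF H(2) b(1)] S J]
      unfolding w_def by (simp add: sum_subtractf right_diff_distrib)
    also have "\<dots> = D a + X"
      unfolding D_def X_def sum.distrib[symmetric]
      by (intro sum.cong) (auto simp: power2_eq_square algebra_simps)
    finally show ?thesis .
  qed
  then have "D a + X \<le> e\<^sup>2 / 4" using b(2) by simp
  \<comment> \<open>\<open>X\<close> exceeds \<open>- e\<^sup>2 / 2\<close> and \<open>D a\<close>
    is at least \<open>e\<^sup>2\<close>, so their sum exceeds \<open>e\<^sup>2 / 2\<close>, against
    the bound \<open>e\<^sup>2 / 4\<close>.\<close>
  then show False using X rM D_ge[OF a(1)] e2 by linarith
qed

text \<open>A basic open set of the product constrains only finitely many coordinates, so one common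
  tolerance on a finite set suffices.\<close>

lemma product_euclideanreal_closure_ofI:
  assumes z: "z \<in> extensional S" and H: "H \<subseteq> extensional S"
    and approx: "\<And>J e. finite J \<Longrightarrow> J \<subseteq> S \<Longrightarrow> e > 0 \<Longrightarrow> \<exists>a\<in>H. \<forall>j\<in>J. \<bar>a j - z j\<bar> < (e::real)"
  shows "z \<in> product_topology (\<lambda>_. euclideanreal) S closure_of H"
  unfolding in_closure_of
proof (intro conjI allI impI)
  show "z \<in> topspace (product_topology (\<lambda>_. euclideanreal) S)"
    using z by (simp add: PiE_iff)
next
  fix U assume "z \<in> U \<and> openin (product_topology (\<lambda>_. euclideanreal) S) U"
  then obtain V where V: "finite {i \<in> S. V i \<noteq> UNIV}" "\<And>i. i \<in> S \<Longrightarrow> open (V i)" "z \<in> Pi\<^sub>E S V" "Pi\<^sub>E S V \<subseteq> U"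
    by (auto simp: openin_product_topology_alt)
  let ?J = "{i \<in> S. V i \<noteq> UNIV}"
  have "\<exists>d>0. \<forall>y. \<bar>y - z i\<bar> < d \<longrightarrow> y \<in> V i" if "i \<in> S" for i
    using V(2)[OF that] V(3) that unfolding open_dist dist_real_def by auto
  then obtain d where d: "\<And>i. i \<in> S \<Longrightarrow> d i > 0" "\<And>i y. i \<in> S \<Longrightarrow> \<bar>y - z i\<bar> < d i \<Longrightarrow> y \<in> V i"
    by metis
  \<comment> \<open>The inserted 1 keeps the minimum defined and positive when no coordinate is
    constrained.\<close>
  define e where "e = Min (insert 1 (d ` ?J))"
  have e: "e > 0" "\<And>i. i \<in> ?J \<Longrightarrow> e \<le> d i"
    using V(1) d(1) by (auto simp: e_def)
  obtain a where a: "a \<in> H" "\<forall>j\<in>?J. \<bar>a j - z j\<bar> < e" using approx[OF V(1) _ e(1)] by auto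
  have "a i \<in> V i" if "i \<in> S" for i
  proof (cases "V i = UNIV")
    case False
    then show ?thesis using a(2) e(2)[of i] that by (intro d(2)) force+
  qed simp
  then have "a \<in> Pi\<^sub>E S V" using a(1) H by (auto simp: PiE_iff)
  then show "\<exists>y. y \<in> H \<and> y \<in> U" using a(1) V(4) by auto
qed

text \<open>Used with \<open>hull_minimal\<close> to carry linearity and the bound \<open>P\<close>
  from generators to their convex hull.\<close>

lemma convex_functionals_bounded:
  assumes S: "subspace S"
  shows "convex_functionals S {\<zeta> \<in> algebraic_dual S. \<forall>v\<in>S. \<bar>\<zeta> v\<bar> \<le> P v}"
proof -
  have "\<bar>u * a v + t * b v\<bar> \<le> P v"
    if "u \<ge> 0" "t \<ge> 0" "u + t = 1" "\<bar>a v\<bar> \<le> P v" "\<bar>b v\<bar> \<le> P v" for u t :: real and a b v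
  proof -
    have "\<bar>u * a v + t * b v\<bar> \<le> u * \<bar>a v\<bar> + t * \<bar>b v\<bar>"
      using abs_triangle_ineq[of "u * a v" "t * b v"] that by (simp add: abs_mult)
    also have "\<dots> \<le> u * P v + t * P v" using that by (intro add_mono mult_left_mono)
    also have "\<dots> = P v" using that by (simp flip: distrib_right)
    finally show ?thesis .
  qed
  then show ?thesis
    using S by (auto simp: convex_functionals_def algebraic_dual_def subspace_add subspace_scale algebra_simps)
qed

lemma convex_functionals_hull: "convex_functionals S (convex_functionals S hull A)"
  by (rule hull_in) (auto simp: convex_functionals_def)

text \<open>The bound \<open>P\<close> passes to the convex hull, and \<open>dual\<close> then
  places the hull in the topological dual. Weak-star closure thus reduces to closure in the product
  topology, which is tested on finitely many coordinates.\<close>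

lemma in_weak_star_closed_convex_hullI:
  assumes S: "subspace (topspace T)" and z: "z \<in> topological_dual T"
    and A: "A \<subseteq> algebraic_dual (topspace T)" "\<And>a v. a \<in> A \<Longrightarrow> v \<in> topspace T \<Longrightarrow> \<bar>a v\<bar> \<le> P v"
    and dual: "\<And>a. a \<in> algebraic_dual (topspace T) \<Longrightarrow> (\<And>v. v \<in> topspace T \<Longrightarrow> \<bar>a v\<bar> \<le> P v)
      \<Longrightarrow> a \<in> topological_dual T"
    and support: "\<And>w r. w \<in> topspace T \<Longrightarrow> r < z w \<Longrightarrow> \<exists>a\<in>A. r \<le> a w"
  shows "z \<in> weak_star_closed_convex_hull T A"
proof -
  let ?S = "topspace T"
  let ?H = "convex_functionals ?S hull A"
  let ?B = "{\<zeta> \<in> algebraic_dual ?S. \<forall>v\<in>?S. \<bar>\<zeta> v\<bar> \<le> P v}"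
  have AH: "A \<subseteq> ?H" by (rule hull_subset)
  have HB: "?H \<subseteq> ?B"
    using A by (intro hull_minimal convex_functionals_bounded[OF S]) auto
  then have HD: "?H \<subseteq> topological_dual T" using dual by blast
  have zd: "z \<in> algebraic_dual ?S" using z by (simp add: topological_dual_def)
  have "z \<in> product_topology (\<lambda>_. euclideanreal) ?S closure_of ?H"
  proof (rule product_euclideanreal_closure_ofI)
    show "z \<in> extensional ?S" "?H \<subseteq> extensional ?S" using zd HB by (auto simp: algebraic_dual_def)
    fix J and e :: real assume "finite J" "J \<subseteq> ?S" "e > 0"
    then show "\<exists>a\<in>?H. \<forall>j\<in>J. \<bar>a j - z j\<bar> < e"
      using HB support AH zd
      by (intro approximate_by_support[OF S _ _ convex_functionals_hull, where P = P]) blast+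
  qed
  then show ?thesis
    using z HD unfolding weak_star_closed_convex_hull_def weak_star_topology_def closure_of_subtopology
    by (simp add: Int_absorb1)
qed

section \<open>The chain rule as an inclusion of subdifferentials\<close>

theorem theorem3p2:
  fixes C :: "'a::real_vector set" and x0 :: 'a
    and h :: "'a \<Rightarrow> real ^ 'n" and g :: "real ^ 'n \<Rightarrow> real" and \<phi> :: "'a \<Rightarrow> real"
    and T :: "'a topology"
  assumes "convex C" and "x0 \<in> C" and "symmetric_wrt C x0"
    and "\<And>i. minkowski_lipschitz C x0 (\<lambda>x. h x $ i)"
    and "\<exists>L. L-lipschitz_on UNIV g"
    and "\<phi> = g \<circ> h"
    and "vector_topology_on (dir_space C x0) T"
    and "continuous_map T euclideanreal (minkowski C x0)"
  shows "\<forall>x \<in> minkowski_ball C x0 1.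
    minkowski_subdifferential C x0 \<phi> x \<subseteq>
      weak_star_closed_convex_hull T
        {(\<lambda>v \<in> dir_space C x0. \<Sum>i\<in>UNIV. \<alpha> $ i * \<zeta> i v) | \<alpha> \<zeta>.
          (\<forall>i. \<zeta> i \<in> minkowski_subdifferential C x0 (\<lambda>y. h y $ i) x) \<and>
          \<alpha> \<in> clarke_subdifferential g (h x)}"
proof (intro ballI subsetI)
  fix x z
  assume x: "x \<in> minkowski_ball C x0 1" and z: "z \<in> minkowski_subdifferential C x0 \<phi> x"
  interpret symmetric_convex C x0 using assms by unfold_locales
  obtain L where L: "L-lipschitz_on UNIV g" using assms by blast
  have L0: "L \<ge> 0" by (rule lipschitz_on_nonneg[OF L])
  have "\<exists>l\<ge>0. \<forall>y\<in>C. \<forall>z\<in>C. \<bar>h y $ i - h z $ i\<bar> \<le> l * \<mu> (y - z)" for i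
    using assms(4)[of i] unfolding minkowski_lipschitz_def by (meson less_imp_le)
  then obtain l where l: "\<And>i. l i \<ge> 0"
    "\<And>i y z. y \<in> C \<Longrightarrow> z \<in> C \<Longrightarrow> \<bar>h y $ i - h z $ i\<bar> \<le> l i * \<mu> (y - z)"
    by metis
  \<comment> \<open>A \<open>\<mu>\<close>-Lipschitz constant of \<open>\<phi>\<close>, from
    bounding the Euclidean norm by the sum of the absolute components. The same constant bounds all
    functionals on the right-hand side.\<close>
  define M where "M = (\<Sum>i\<in>UNIV. L * l i)"
  have M0: "M \<ge> 0" unfolding M_def using L0 l(1) by (intro sum_nonneg) auto
  let ?N = "minkowski_nhds C x0 x"
  have h: "clarke_setting S ?N (\<lambda>y. h y $ i) (\<lambda>v. l i * \<mu> v)" for i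
    using x l by (intro clarke_setting_minkowski) auto
  have \<phi>_lipschitz: "\<bar>\<phi> y - \<phi> z\<bar> \<le> M * \<mu> (y - z)" if "y \<in> C" "z \<in> C" for y z
  proof -
    have "\<bar>\<phi> y - \<phi> z\<bar> \<le> L * norm (h y - h z)"
      using lipschitz_onD[OF L, of "h y" "h z"] by (simp add: assms(6) dist_norm)
    also have "\<dots> \<le> L * (\<Sum>i\<in>UNIV. \<bar>(h y - h z) $ i\<bar>)"
      using L0 by (intro mult_left_mono norm_le_l1_cart)
    also have "\<dots> \<le> L * (\<Sum>i\<in>UNIV. l i * \<mu> (y - z))"
      using L0 l(2)[OF that] by (intro mult_left_mono sum_mono) auto
    also have "\<dots> = M * \<mu> (y - z)"
      by (simp add: M_def sum_distrib_left sum_distrib_right mult.assoc)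
    finally show ?thesis .
  qed
  interpret \<phi>: clarke_setting S ?N \<phi> "\<lambda>v. M * \<mu> v"
    using x M0 \<phi>_lipschitz by (rule clarke_setting_minkowski)
  have top: "topspace T = S" using assms(7) by (simp add: vector_topology_on_def)
  have uminus_le: "c * \<mu> (- v) \<le> c * \<mu> v" if "c \<ge> 0" "v \<in> S" for c v
    using that by (intro mult_left_mono minkowski_uminus_le)
  let ?A = "{(\<lambda>v \<in> S. \<Sum>i\<in>UNIV. \<alpha> $ i * \<zeta> i v) | \<alpha> \<zeta>.
    (\<forall>i. \<zeta> i \<in> minkowski_subdifferential C x0 (\<lambda>y. h y $ i) x) \<and> \<alpha> \<in> clarke_subdifferential g (h x)}"
  have zd: "z \<in> algebraic_dual S" and z_le: "\<And>v. v \<in> S \<Longrightarrow> ereal (z v) \<le> clarke_derivative ?N \<phi> v"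
    using z by (auto simp: minkowski_subdifferential_def)
  have dual: "a \<in> topological_dual T" if "a \<in> algebraic_dual S" "\<And>v. v \<in> S \<Longrightarrow> \<bar>a v\<bar> \<le> M * \<mu> v" for a
    using assms(7,8) that by (rule bounded_in_topological_dual)
  show "z \<in> weak_star_closed_convex_hull T ?A"
  proof (rule in_weak_star_closed_convex_hullI[where P = "\<lambda>v. M * \<mu> v"], unfold top)
    \<comment> \<open>Being a subgradient of a \<open>\<mu>\<close>-Lipschitz function,
      \<open>z\<close> is bounded by \<open>M * \<mu> v\<close> and hence continuous.\<close>
    show "z \<in> topological_dual T"
      using zd \<phi>.subgradient_bound[OF zd z_le] uminus_le[OF M0] by (intro dual) auto
    show "?A \<subseteq> algebraic_dual S"
    proof
      fix a assume "a \<in> ?A"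
      then obtain \<alpha> \<zeta> where a: "a = (\<lambda>v \<in> S. \<Sum>i\<in>UNIV. \<alpha> $ i * \<zeta> i v)"
        and "\<forall>i. \<zeta> i \<in> minkowski_subdifferential C x0 (\<lambda>y. h y $ i) x" by auto
      then have \<zeta>: "\<zeta> i \<in> algebraic_dual S" for i by (simp add: minkowski_subdifferential_def)
      show "a \<in> algebraic_dual S"
        using subspace_S unfolding a algebraic_dual_def
        by (auto simp: subspace_add subspace_scale algebraic_dualD[OF \<zeta>] distrib_left sum.distrib
            sum_distrib_left mult.left_commute)
    qed
    \<comment> \<open>Each \<open>\<alpha> $ i\<close> is at most \<open>L\<close> and each
      \<open>\<zeta> i v\<close> at most \<open>l i * \<mu> v\<close> in absolute value; the
      products sum to the constant \<open>M\<close>.\<close>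
    show "\<bar>a v\<bar> \<le> M * \<mu> v" if "a \<in> ?A" and v: "v \<in> S" for a v
    proof -
      obtain \<alpha> \<zeta> where a: "a = (\<lambda>v \<in> S. \<Sum>i\<in>UNIV. \<alpha> $ i * \<zeta> i v)"
        and \<zeta>: "\<And>i. \<zeta> i \<in> minkowski_subdifferential C x0 (\<lambda>y. h y $ i) x"
        and \<alpha>: "\<alpha> \<in> clarke_subdifferential g (h x)" using \<open>a \<in> ?A\<close> by auto
      have \<zeta>_le: "\<bar>\<zeta> i v\<bar> \<le> l i * \<mu> v" for i
        using \<zeta>[of i] v uminus_le[OF l(1)[of i]] unfolding minkowski_subdifferential_def
        by (intro clarke_setting.subgradient_bound[OF h]) auto
      have "\<bar>a v\<bar> \<le> (\<Sum>i\<in>UNIV. \<bar>\<alpha> $ i * \<zeta> i v\<bar>)"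
        using v by (simp add: a sum_abs)
      also have "\<dots> \<le> (\<Sum>i\<in>UNIV. L * (l i * \<mu> v))"
        unfolding abs_mult
        using \<zeta>_le clarke_subdifferential_component_le[OF L \<alpha>] L0 by (intro sum_mono mult_mono) auto
      also have "\<dots> = M * \<mu> v" by (simp add: M_def sum_distrib_right mult.assoc)
      finally show ?thesis .
    qed
    show "\<exists>a\<in>?A. r \<le> a w" if w: "w \<in> S" and r: "r < z w" for w r
    proof -
      \<comment> \<open>As \<open>z w\<close> is at most the derivative of \<open>\<phi>\<close> in
        direction \<open>w\<close>, any smaller \<open>r\<close> is admissible in the directional
        chain rule.\<close>
      have "ereal r < clarke_derivative ?N (g \<circ> h) w"
        using less_le_trans[OF _ z_le[OF w], of "ereal r"] r by (simp add: assms(6))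
      then obtain \<alpha> \<zeta> where "\<alpha> \<in> clarke_subdifferential g (h x)"
        "\<And>i. \<zeta> i \<in> algebraic_dual S"
        "\<And>i u. u \<in> S \<Longrightarrow> ereal (\<zeta> i u) \<le> clarke_derivative ?N (\<lambda>y. h y $ i) u"
        "r \<le> (\<Sum>i\<in>UNIV. \<alpha> $ i * \<zeta> i w)"
        using chain_rule_directional[OF h filterlim_minkowski_lipschitz[OF x l(2)] L w] by blast
      moreover from this have "\<forall>i. \<zeta> i \<in> minkowski_subdifferential C x0 (\<lambda>y. h y $ i) x"
        by (simp add: minkowski_subdifferential_def)
      ultimately show ?thesis
        using w by (intro bexI[of _ "\<lambda>v\<in>S. \<Sum>i\<in>UNIV. \<alpha> $ i * \<zeta> i v"]) auto
    qed
  qed (use subspace_S dual in auto)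
qed

end
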